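(* Let $X$ be a finite set, and let $\mathbb{K}$ be a field whose characteristic is either $0$ or greater than $|X|$. Then the maximal semisimple image $\mathbb{K}[\mathcal{P}^{\mathrm{fd}}_X]/\mathrm{Rad}\,\mathbb{K}[\mathcal{P}^{\mathrm{fd}}_X]$ of the semigroup algebra of the full-domain partition monoid $\mathcal{P}^{\mathrm{fd}}_X$ is isomorphic, as a $\mathbb{K}$-algebra, to the semigroup algebra $\mathbb{K}[\mathcal{J}_X]$ of the dual symmetric inverse monoid $\mathcal{J}_X$.
   Context: Partition monoid: let $X$ be a set and $X'=\{x':x\in X\}$ a disjoint copy of $X$. $\mathcal{P}_X$ is the set of all set partitions of $X\cup X'$. Given $\alpha,\beta\in\mathcal{P}_X$, let $X''=\{x'':x\in X\}$ be another disjoint copy; represent $\alpha$ and $\beta$ by graphs on $X\cup X'$ whose connected components are the blocks; rename each lower vertex $x'$ of $\alpha$ to $x''$ and each upper vertex $x$ of $\beta$ to $x''$; take the union of these graphs on $X\cup X''\cup X'$. The product $\alpha\beta$ is the partition of $X\cup X'$ in which two elements lie in the same block iff they are joined by a path in this union graph. This makes $\mathcal{P}_X$ a monoid. A block is a transversal if it meets both $X$ and $X'$. $\mathrm{dom}(\alpha)$ (resp. $\mathrm{codom}(\alpha)$) is the set of $x\in X$ such that $x$ (resp. $x'$) belongs to a transversal of $\alpha$. Define the submonoids $\mathcal{P}^{\mathrm{fd}}_X=\{\alpha\in\mathcal{P}_X:\mathrm{dom}(\alpha)=X\}$ (full-domain partitions) and $\mathcal{J}_X=\{\alpha\in\mathcal{P}_X:\mathrm{dom}(\alpha)=\mathrm{codom}(\alpha)=X\}$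 (dual symmetric inverse monoid). For a finite monoid $S$, $\mathbb{K}[S]$ is the algebra with $\mathbb{K}$-basis $S$ and multiplication extending that of $S$ bilinearly, and $\mathrm{Rad}$ denotes the Jacobson radical. *)

theory Defs
  imports "HOL-Algebra.QuotRing" "HOL-Algebra.Module" "HOL-Library.Disjoint_Sets"
begin

section \<open>The partition monoid\<close>

text \<open>The vertex $x$ is \<^term>\<open>Inl x\<close> and its copy $x'$ is \<^term>\<open>Inr x\<close>.\<close>

definition vertices :: "'a set \<Rightarrow> ('a + 'a) set" where
  "vertices X = Inl ` X \<union> Inr ` X"

type_synonym 'a part = "('a + 'a) set set"

datatype 'a layer = Upper 'a | Middle 'a | Lower 'a

text \<open>The product graph lives on the three copies $X \cup X'' \cup X'$. A partition is represented by
  the graph in which every block is a clique; it is placed on the top two layers if it is the left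
  factor and on the bottom two layers if it is the right factor.\<close>

definition product_graph :: "'a part \<Rightarrow> 'a part \<Rightarrow> 'a layer rel" where
  "product_graph \<alpha> \<beta> =
     {(case_sum Upper Middle u, case_sum Upper Middle v) | u v. \<exists>B\<in>\<alpha>. u \<in> B \<and> v \<in> B} \<union>
     {(case_sum Middle Lower u, case_sum Middle Lower v) | u v. \<exists>B\<in>\<beta>. u \<in> B \<and> v \<in> B}"

definition part_mult :: "'a set \<Rightarrow> 'a part \<Rightarrow> 'a part \<Rightarrow> 'a part" where
  "part_mult X \<alpha> \<beta> =
     vertices X // {(u, v) \<in> vertices X \<times> vertices X.
        (case_sum Upper Lower u, case_sum Upper Lower v) \<in> (product_graph \<alpha> \<beta>)\<^sup>*}"

definition partition_monoid :: "'a set \<Rightarrow> 'a part monoid" where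
  "partition_monoid X =
     \<lparr>carrier = {\<alpha>. partition_on (vertices X) \<alpha>},
      mult = part_mult X,
      one = (\<lambda>x. {Inl x, Inr x}) ` X\<rparr>"

definition transversal :: "('a + 'a) set \<Rightarrow> bool" where
  "transversal B \<longleftrightarrow> (\<exists>x. Inl x \<in> B) \<and> (\<exists>y. Inr y \<in> B)"

definition part_dom :: "'a part \<Rightarrow> 'a set" where
  "part_dom \<alpha> = {x. \<exists>B\<in>\<alpha>. transversal B \<and> Inl x \<in> B}"

definition part_codom :: "'a part \<Rightarrow> 'a set" where
  "part_codom \<alpha> = {x. \<exists>B\<in>\<alpha>. transversal B \<and> Inr x \<in> B}"

definition full_domain_monoid :: "'a set \<Rightarrow> 'a part monoid" where
  "full_domain_monoid X =
     (partition_monoid X)\<lparr>carrier := {\<alpha> \<in> carrier (partition_monoid X). part_dom \<alpha> = X}\<rparr>"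

definition dual_symmetric_inverse_monoid :: "'a set \<Rightarrow> 'a part monoid" where
  "dual_symmetric_inverse_monoid X =
     (partition_monoid X)\<lparr>carrier :=
        {\<alpha> \<in> carrier (partition_monoid X). part_dom \<alpha> = X \<and> part_codom \<alpha> = X}\<rparr>"


section \<open>Algebras over a field\<close>

text \<open>A not necessarily commutative algebra over the field \<^typ>\<open>'k\<close> is carried by the record type
  \<^typ>\<open>('k, 'b) module\<close>. (The locale \<^locale>\<open>algebra\<close> is not used, as it demands a commutative ring.)\<close>

text \<open>Only meaningful for a finite monoid: the element $\sum_s f(s)\, s$ of the semigroup algebra is
  the function \<^term>\<open>f\<close>, extended by zero outside the monoid.\<close>

definition semigroup_algebra ::
    "('s, 'm) monoid_scheme \<Rightarrow> ('k::field, 's \<Rightarrow> 'k) module" where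
  "semigroup_algebra S =
     \<lparr>carrier = {f. \<forall>s. s \<notin> carrier S \<longrightarrow> f s = 0},
      mult = (\<lambda>f g s. \<Sum>(t, u) \<in> {(t, u) \<in> carrier S \<times> carrier S. t \<otimes>\<^bsub>S\<^esub> u = s}. f t * g u),
      one = (\<lambda>s. if s = \<one>\<^bsub>S\<^esub> then 1 else 0),
      zero = (\<lambda>s. 0),
      add = (\<lambda>f g s. f s + g s),
      smult = (\<lambda>c f s. c * f s)\<rparr>"

definition left_ideal :: "'b set \<Rightarrow> ('b, 'm) ring_scheme \<Rightarrow> bool" where
  "left_ideal I R \<longleftrightarrow>
     additive_subgroup I R \<and> (\<forall>a\<in>carrier R. \<forall>x\<in>I. a \<otimes>\<^bsub>R\<^esub> x \<in> I)"

definition maximal_left_ideal :: "'b set \<Rightarrow> ('b, 'm) ring_scheme \<Rightarrow> bool" where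
  "maximal_left_ideal I R \<longleftrightarrow>
     left_ideal I R \<and> I \<noteq> carrier R \<and>
     (\<forall>J. left_ideal J R \<and> I \<subseteq> J \<longrightarrow> J = I \<or> J = carrier R)"

definition jacobson_radical :: "('b, 'm) ring_scheme \<Rightarrow> 'b set" where
  "jacobson_radical R = carrier R \<inter> \<Inter>{I. maximal_left_ideal I R}"

text \<open>The scalar multiplication on cosets is defined in the style of \<^const>\<open>rcoset_mult\<close>: all the
  cosets in the union coincide when \<^term>\<open>I\<close> is an ideal.\<close>

definition quotient_algebra ::
    "('k, 'b, 'm) module_scheme \<Rightarrow> 'b set \<Rightarrow> ('k, 'b set) module" where
  "quotient_algebra A I =
     ring.extend (A Quot I)
       (module.fields (\<lambda>c C. \<Union>x\<in>C. I +>\<^bsub>A\<^esub> (c \<odot>\<^bsub>A\<^esub> x)))"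

definition algebra_iso ::
    "('k, 'b, 'm) module_scheme \<Rightarrow> ('k, 'c, 'n) module_scheme \<Rightarrow> ('b \<Rightarrow> 'c) set" where
  "algebra_iso A B =
     {\<phi> \<in> ring_iso A B. \<forall>c. \<forall>x\<in>carrier A. \<phi> (c \<odot>\<^bsub>A\<^esub> x) = c \<odot>\<^bsub>B\<^esub> \<phi> x}"

definition algebra_isomorphic ::
    "('k, 'b, 'm) module_scheme \<Rightarrow> ('k, 'c, 'n) module_scheme \<Rightarrow> bool"
    (infix \<open>\<simeq>\<^sub>a\<^sub>l\<^sub>g\<close> 60) where
  "A \<simeq>\<^sub>a\<^sub>l\<^sub>g B \<longleftrightarrow> algebra_iso A B \<noteq> {}"

end

theory Submission
  imports Defs "HOL.Vector_Spaces" "HOL-Library.Function_Algebras" "HOL-Combinatorics.Permutations"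
begin

text \<open>
  A full-domain partition \<open>\<alpha>\<close> is the same thing as an injective map from \<open>X / ker \<alpha>\<close> to
  \<open>X / coker \<alpha>\<close>, where the classes of the equivalence relations \<open>ker \<alpha>\<close> and \<open>coker \<alpha>\<close> are the traces of
  the blocks of \<open>\<alpha>\<close> on the upper and the lower vertices. Such maps form a finite category whose
  objects are the equivalence relations on \<open>X\<close>; its isomorphisms are the elements of \<open>\<J>\<^sub>X\<close>. Moebius
  inversion identifies the semigroup algebra with the algebra of this category, and the
  semigroup algebra of \<open>\<J>\<^sub>X\<close> with the algebra of the groupoid of isomorphisms. The
  non-isomorphisms span a nilpotent ideal, because they strictly increase the number of classes,
  and the groupoid algebra is semisimple by Maschke's theorem, as the vertex groups are symmetric
  groups of degree at most \<open>|X|\<close>. Hence this ideal is the radical and the quotient by it is the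
  groupoid algebra.

  The proof needs from the category only the composite \<open>\<psi>\<close> (\<open>groupoid_map\<close>) of the two maps from the
  semigroup algebra to the groupoid algebra: \<open>\<psi>\<close> sends \<open>\<alpha>\<close> to the sum of its restrictions \<open>\<alpha> e\<close>, \<open>e\<close> an
  equivalence relation, that lie in \<open>\<J>\<^sub>X\<close> and have cokernel \<open>e\<close>. It is multiplicative
  (\<open>groupoid_map_mult\<close>), it is bijective on the span of \<open>\<J>\<^sub>X\<close> because it is unitriangular there
  (\<open>groupoid_map_surj\<close>, \<open>groupoid_map_inj\<close>), its kernel is nil (\<open>kernel_nil\<close>) and therefore contained in
  the radical, and Maschke's theorem for the vertex groups shows that the radical is contained in the
  kernel (\<open>radical_le_kernel\<close>). So the radical is the kernel, and the span of \<open>\<J>\<^sub>X\<close> is a system of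
  representatives for its cosets (\<open>quotient_kernel_iso\<close>).

  All this is carried out for a submonoid \<open>S\<close> of a finite regular \<open>\<star>\<close>-monoid \<open>T\<close> such that left factors
  of elements of \<open>S\<close> lie in \<open>S\<close> and the projections \<open>x x\<^sup>\<star>\<close> with \<open>x \<in> S\<close> commute; \<open>\<J>\<^sub>X\<close> becomes
  \<open>S \<inter> S\<^sup>\<star>\<close>. Being inside \<open>T\<close>, where \<open>\<alpha>\<close> can be turned upside down even if it is not in \<open>\<J>\<^sub>X\<close>, reduces the
  nilpotency to the algebra of Green's relation \<open>L\<close> (\<open>kernel_left_mult_vanishes\<close>). It remains to see
  that the partition monoid and its full-domain partitions satisfy these axioms
  (\<open>partition_star_submonoid\<close>) and to count the maximal subgroups
  (\<open>block_bijections_permutations\<close>).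
\<close>

section \<open>The Jacobson radical of a ring\<close>

lemma (in ring) left_idealI:
  assumes "I \<subseteq> carrier R" "\<zero> \<in> I"
    and "\<And>x y. x \<in> I \<Longrightarrow> y \<in> I \<Longrightarrow> x \<oplus> y \<in> I"
    and mult: "\<And>a x. a \<in> carrier R \<Longrightarrow> x \<in> I \<Longrightarrow> a \<otimes> x \<in> I"
  shows "left_ideal I R"
proof -
  have "\<ominus> x \<in> I" if "x \<in> I" for x
  proof -
    have x: "x \<in> carrier R" using that assms(1) by blast
    have "\<ominus> \<one> \<otimes> x \<in> I" by (rule mult) (use that in auto)
    then show ?thesis using x by (simp add: l_minus)
  qed
  then have "subgroup I (add_monoid R)"
    using assms(1-3) by (intro add.subgroupI) (auto simp: a_inv_def)
  then show ?thesis
    using mult by (simp add: left_ideal_def additive_subgroup_def)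
qed

lemma (in ring) left_idealD:
  assumes "left_ideal I R"
  shows "I \<subseteq> carrier R" "\<zero> \<in> I" "\<And>x y. x \<in> I \<Longrightarrow> y \<in> I \<Longrightarrow> x \<oplus> y \<in> I"
    and "\<And>a x. a \<in> carrier R \<Longrightarrow> x \<in> I \<Longrightarrow> a \<otimes> x \<in> I"
proof -
  have add: "additive_subgroup I R" using assms by (simp add: left_ideal_def)
  show "I \<subseteq> carrier R" by (rule additive_subgroup.a_subset[OF add])
  show "\<zero> \<in> I" by (rule additive_subgroup.zero_closed[OF add])
  show "x \<oplus> y \<in> I" if "x \<in> I" "y \<in> I" for x y
    by (rule additive_subgroup.a_closed[OF add that])
  show "a \<otimes> x \<in> I" if "a \<in> carrier R" "x \<in> I" for a x
    using assms that by (simp add: left_ideal_def)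
qed

lemma (in ring) left_ideal_eq_carrier:
  assumes "left_ideal I R" "\<one> \<in> I"
  shows "I = carrier R"
proof
  show "carrier R \<subseteq> I"
    using left_idealD(4)[OF assms(1) _ assms(2)] by auto
qed (rule left_idealD(1)[OF assms(1)])

text \<open>Zorn's lemma applies because a union of proper left ideals still misses the unit.\<close>

lemma (in ring) proper_left_ideal_in_maximal:
  assumes I: "left_ideal I R" and one: "\<one> \<notin> I"
  shows "\<exists>M. maximal_left_ideal M R \<and> I \<subseteq> M"
proof -
  let ?P = "{J. left_ideal J R \<and> I \<subseteq> J \<and> \<one> \<notin> J}"
  have "\<exists>M\<in>?P. \<forall>Y\<in>?P. M \<subseteq> Y \<longrightarrow> Y = M"
  proof (rule subset_Zorn_nonempty)
    show "?P \<noteq> {}" using assms by blast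
    fix C assume C: "C \<noteq> {}" "subset.chain ?P C"
    then have CP: "\<And>J. J \<in> C \<Longrightarrow> left_ideal J R \<and> I \<subseteq> J \<and> \<one> \<notin> J"
      by (auto simp: subset.chain_def)
    obtain J0 where J0: "J0 \<in> C" using C by blast
    have "left_ideal (\<Union>C) R"
    proof (rule left_idealI)
      show "\<Union>C \<subseteq> carrier R" using CP left_idealD(1) by blast
      show "\<zero> \<in> \<Union>C" using CP[OF J0] left_idealD(2) J0 by blast
      show "a \<otimes> x \<in> \<Union>C" if "a \<in> carrier R" "x \<in> \<Union>C" for a x
        using that CP left_idealD(4) by blast
      fix x y assume "x \<in> \<Union>C" "y \<in> \<Union>C"
      then obtain J K where JK: "J \<in> C" "K \<in> C" "x \<in> J" "y \<in> K" by blast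
      then have "J \<subseteq> K \<or> K \<subseteq> J" using C by (auto simp: subset_chain_def)
      then obtain L where "L \<in> C" "x \<in> L" "y \<in> L" using JK by blast
      then show "x \<oplus> y \<in> \<Union>C" using CP left_idealD(3) by blast
    qed
    then show "\<Union>C \<in> ?P" using CP J0 by blast
  qed
  then obtain M where MP: "M \<in> ?P" and max: "\<forall>Y\<in>?P. M \<subseteq> Y \<longrightarrow> Y = M" by (rule bexE)
  then have M: "left_ideal M R" "I \<subseteq> M" "\<one> \<notin> M" by auto
  have "J = M \<or> J = carrier R" if "left_ideal J R" "M \<subseteq> J" for J
  proof (cases "\<one> \<in> J")
    case True
    then show ?thesis using left_ideal_eq_carrier[OF that(1)] by simp
  next
    case False
    then have "J \<in> ?P" using that M(2) by auto
    then show ?thesis using max that(2) by blast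
  qed
  then show ?thesis
    using M unfolding maximal_left_ideal_def by blast
qed

lemma (in ring) left_ideal_jacobson_radical: "left_ideal (jacobson_radical R) R"
proof (rule left_idealI)
  show "\<zero> \<in> jacobson_radical R"
    using left_idealD(2) by (auto simp: jacobson_radical_def maximal_left_ideal_def)
  show "x \<oplus> y \<in> jacobson_radical R"
    if "x \<in> jacobson_radical R" "y \<in> jacobson_radical R" for x y
    using that left_idealD(3) by (auto simp: jacobson_radical_def maximal_left_ideal_def)
  show "a \<otimes> x \<in> jacobson_radical R" if "a \<in> carrier R" "x \<in> jacobson_radical R" for a x
    using that left_idealD(4) by (auto simp: jacobson_radical_def maximal_left_ideal_def)
qed (auto simp: jacobson_radical_def)

text \<open>Otherwise \<open>R (1 - x)\<close> is a proper left ideal, and a maximal left ideal above it contains both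
  \<open>x\<close> and \<open>1 - x\<close>.\<close>

lemma (in ring) jacobson_radical_left_invertible:
  assumes x: "x \<in> jacobson_radical R"
  shows "\<exists>z\<in>carrier R. z \<otimes> (\<one> \<ominus> x) = \<one>"
proof (rule ccontr)
  assume no: "\<not> ?thesis"
  have xc: "x \<in> carrier R" using x by (simp add: jacobson_radical_def)
  let ?I = "(\<lambda>z. z \<otimes> (\<one> \<ominus> x)) ` carrier R"
  have "left_ideal ?I R"
  proof (rule left_idealI)
    show "\<zero> \<in> ?I" using xc by (intro image_eqI[of _ _ \<zero>]) auto
    show "u \<oplus> v \<in> ?I" if uv: "u \<in> ?I" "v \<in> ?I" for u v
    proof -
      obtain z w where "z \<in> carrier R" "w \<in> carrier R" "u = z \<otimes> (\<one> \<ominus> x)" "v = w \<otimes> (\<one> \<ominus> x)"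
        using uv by blast
      then show ?thesis using xc by (intro image_eqI[of _ _ "z \<oplus> w"]) (auto simp: l_distr)
    qed
    show "a \<otimes> u \<in> ?I" if a: "a \<in> carrier R" and u: "u \<in> ?I" for a u
    proof -
      obtain z where "z \<in> carrier R" "u = z \<otimes> (\<one> \<ominus> x)" using u by blast
      then show ?thesis using xc a by (intro image_eqI[of _ _ "a \<otimes> z"]) (auto simp: m_assoc)
    qed
  qed (use xc in auto)
  moreover have "\<one> \<notin> ?I" using no by force
  ultimately obtain M where M: "maximal_left_ideal M R" "?I \<subseteq> M"
    using proper_left_ideal_in_maximal by blast
  then have LM: "left_ideal M R" by (simp add: maximal_left_ideal_def)
  have "x \<in> M" using x M by (auto simp: jacobson_radical_def)
  moreover have "\<one> \<ominus> x \<in> M"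
    using M(2) xc by (auto intro!: subsetD[OF M(2)] image_eqI[of _ _ \<one>])
  ultimately have "(\<one> \<ominus> x) \<oplus> x \<in> M" using left_idealD(3)[OF LM] by blast
  moreover have "(\<one> \<ominus> x) \<oplus> x = \<one>" using xc by (simp add: minus_eq a_assoc l_neg)
  ultimately show False
    using M(1) left_ideal_eq_carrier[OF LM] by (simp add: maximal_left_ideal_def)
qed

text \<open>The inverse is the truncated geometric series.\<close>

lemma (in ring) nilpotent_left_invertible:
  fixes k :: nat
  assumes n: "n \<in> carrier R" and nil: "n [^] k = \<zero>"
  shows "\<exists>z\<in>carrier R. z \<otimes> (\<one> \<ominus> n) = \<one>"
proof -
  have "\<exists>z\<in>carrier R. z \<otimes> (\<one> \<ominus> n) = \<one> \<ominus> n [^] k" for k :: nat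
  proof (induction k)
    case 0
    show ?case using n by (intro bexI[of _ \<zero>]) (auto simp: a_minus_def r_neg)
  next
    case (Suc k)
    then obtain z where z: "z \<in> carrier R" "z \<otimes> (\<one> \<ominus> n) = \<one> \<ominus> n [^] k" by blast
    have p: "n [^] k \<in> carrier R" using n by simp
    have "(z \<oplus> n [^] k) \<otimes> (\<one> \<ominus> n) = (\<one> \<ominus> n [^] k) \<oplus> n [^] k \<otimes> (\<one> \<ominus> n)"
      using z n p by (simp add: l_distr)
    also have "\<dots> = \<one> \<ominus> n [^] k \<otimes> n"
      using n p by (simp add: a_minus_def r_distr r_minus a_assoc r_neg1)
    finally show ?case
      using z p by (intro bexI[of _ "z \<oplus> n [^] k"]) auto
  qed
  from this[of k] show ?thesis
    using nil by (simp add: minus_eq)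
qed

text \<open>If a maximal left ideal \<open>M\<close> does not contain \<open>N\<close>, then \<open>M + N\<close> contains the unit, so \<open>M\<close> contains some
  \<open>1 - n\<close> with \<open>n\<close> nilpotent, which is left invertible.\<close>

lemma (in ring) nil_left_ideal_le_jacobson_radical:
  assumes N: "left_ideal N R" and nil: "\<And>n. n \<in> N \<Longrightarrow> \<exists>k::nat. n [^] k = \<zero>"
  shows "N \<subseteq> jacobson_radical R"
proof -
  have "N \<subseteq> M" if M: "maximal_left_ideal M R" for M
  proof -
    have LM: "left_ideal M R" using M by (simp add: maximal_left_ideal_def)
    let ?K = "{m \<oplus> n | m n. m \<in> M \<and> n \<in> N}"
    have MK: "M \<subseteq> ?K" and NK: "N \<subseteq> ?K"
    proof -
      show "M \<subseteq> ?K"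
      proof
        fix m assume "m \<in> M"
        moreover have "m = m \<oplus> \<zero>" using \<open>m \<in> M\<close> left_idealD(1)[OF LM] by auto
        ultimately show "m \<in> ?K" using left_idealD(2)[OF N] by blast
      qed
      show "N \<subseteq> ?K"
      proof
        fix m assume "m \<in> N"
        moreover have "m = \<zero> \<oplus> m" using \<open>m \<in> N\<close> left_idealD(1)[OF N] by auto
        ultimately show "m \<in> ?K" using left_idealD(2)[OF LM] by blast
      qed
    qed
    have "left_ideal ?K R"
    proof (rule left_idealI)
      show "?K \<subseteq> carrier R" using left_idealD(1)[OF LM] left_idealD(1)[OF N] by blast
      show "\<zero> \<in> ?K" using MK left_idealD(2)[OF LM] by blast
      show "x \<oplus> y \<in> ?K" if xy: "x \<in> ?K" "y \<in> ?K" for x y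
      proof -
        obtain m n m' n' where *: "m \<in> M" "n \<in> N" "m' \<in> M" "n' \<in> N" "x = m \<oplus> n" "y = m' \<oplus> n'"
          using xy by blast
        have "x \<oplus> y = (m \<oplus> m') \<oplus> (n \<oplus> n')"
          using * subsetD[OF left_idealD(1)[OF LM]] subsetD[OF left_idealD(1)[OF N]]
          by (simp add: a_ac)
        then show ?thesis using * left_idealD(3)[OF LM] left_idealD(3)[OF N] by blast
      qed
      show "a \<otimes> x \<in> ?K" if a: "a \<in> carrier R" and xx: "x \<in> ?K" for a x
      proof -
        obtain m n where *: "m \<in> M" "n \<in> N" "x = m \<oplus> n" using xx by blast
        have "a \<otimes> x = a \<otimes> m \<oplus> a \<otimes> n"
          using * a subsetD[OF left_idealD(1)[OF LM]] subsetD[OF left_idealD(1)[OF N]]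
          by (simp add: r_distr)
        then show ?thesis using * a left_idealD(4)[OF LM] left_idealD(4)[OF N] by blast
      qed
    qed
    then consider "?K = M" | "?K = carrier R"
      using M MK unfolding maximal_left_ideal_def by blast
    then show ?thesis
    proof cases
      case 1
      then show ?thesis using NK by blast
    next
      case 2
      then have "\<one> \<in> ?K" by simp
      then obtain m n where mn: "m \<in> M" "n \<in> N" "\<one> = m \<oplus> n" by blast
      have c: "m \<in> carrier R" "n \<in> carrier R"
        using mn left_idealD(1)[OF LM] left_idealD(1)[OF N] by auto
      obtain z where z: "z \<in> carrier R" "z \<otimes> (\<one> \<ominus> n) = \<one>"
        using nil[OF mn(2)] nilpotent_left_invertible[OF c(2)] by blast
      have "\<one> \<ominus> n = m" using mn(3) c by (simp add: minus_eq a_assoc r_neg)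
      then have "\<one> \<in> M" using z left_idealD(4)[OF LM z(1) mn(1)] by simp
      then show ?thesis
        using left_ideal_eq_carrier[OF LM] M by (simp add: maximal_left_ideal_def)
    qed
  qed
  then show ?thesis
    using left_idealD(1)[OF N] by (auto simp: jacobson_radical_def)
qed

section \<open>Semigroup algebras\<close>

definition factorisations :: "('s, 'm) monoid_scheme \<Rightarrow> 's \<Rightarrow> ('s \<times> 's) set" where
  "factorisations S s = {p \<in> carrier S \<times> carrier S. fst p \<otimes>\<^bsub>S\<^esub> snd p = s}"

lemma finite_factorisations: "finite (carrier S) \<Longrightarrow> finite (factorisations S s)"
  unfolding factorisations_def by (rule finite_subset[of _ "carrier S \<times> carrier S"]) auto

lemma semigroup_algebra_simps [simp]:
  "carrier (semigroup_algebra S) = {f. \<forall>s. s \<notin> carrier S \<longrightarrow> f s = 0}"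
  "one (semigroup_algebra S) = (\<lambda>s. if s = \<one>\<^bsub>S\<^esub> then 1 else 0)"
  "zero (semigroup_algebra S) = (\<lambda>s. 0)"
  "add (semigroup_algebra S) = (\<lambda>f g s. f s + g s)"
  "smult (semigroup_algebra S) = (\<lambda>c f s. c * f s)"
  by (simp_all add: semigroup_algebra_def)

lemma semigroup_algebra_mult:
  "monoid.mult (semigroup_algebra S) f g = (\<lambda>s. \<Sum>p\<in>factorisations S s. f (fst p) * g (snd p))"
  by (auto simp: semigroup_algebra_def factorisations_def intro!: sum.cong)

text \<open>Associativity holds as both bracketings sum over all factorisations of an element into three
  factors.\<close>

lemma semigroup_algebra_ring:
  assumes "monoid S" and fin: "finite (carrier S)"
  shows "ring (semigroup_algebra S :: ('k::field, 's \<Rightarrow> 'k) module)" (is "ring ?A")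
proof -
  interpret monoid S by fact
  let ?P = "factorisations S"
  note P = finite_factorisations[OF fin]
  have ab: "abelian_group ?A"
  proof (rule abelian_groupI)
    show "\<exists>y\<in>carrier ?A. y \<oplus>\<^bsub>?A\<^esub> x = \<zero>\<^bsub>?A\<^esub>" if "x \<in> carrier ?A" for x
      using that by (intro bexI[of _ "\<lambda>s. - x s"]) auto
  qed (auto simp: algebra_simps)
  have mon: "monoid ?A"
  proof (rule monoidI)
    show "f \<otimes>\<^bsub>?A\<^esub> g \<in> carrier ?A" for f g
    proof -
      have "?P s = {}" if "s \<notin> carrier S" for s
        using that by (auto simp: factorisations_def)
      then show ?thesis by (simp add: semigroup_algebra_mult)
    qed
    show "\<one>\<^bsub>?A\<^esub> \<in> carrier ?A" by auto
    show "(f \<otimes>\<^bsub>?A\<^esub> g) \<otimes>\<^bsub>?A\<^esub> h = f \<otimes>\<^bsub>?A\<^esub> (g \<otimes>\<^bsub>?A\<^esub> h)" for f g h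
    proof
      fix s
      have "((f \<otimes>\<^bsub>?A\<^esub> g) \<otimes>\<^bsub>?A\<^esub> h) s = (\<Sum>p\<in>?P s. \<Sum>q\<in>?P (fst p). f (fst q) * g (snd q) * h (snd p))"
        by (simp add: semigroup_algebra_mult sum_distrib_right)
      also have "\<dots> = (\<Sum>(p, q)\<in>(SIGMA p:?P s. ?P (fst p)). f (fst q) * g (snd q) * h (snd p))"
        by (rule sum.Sigma) (auto simp: P)
      also have "\<dots> = (\<Sum>(p, q)\<in>(SIGMA p:?P s. ?P (snd p)). f (fst p) * g (fst q) * h (snd q))"
        by (rule sum.reindex_bij_witness
            [of _ "\<lambda>(p, q). ((fst p \<otimes>\<^bsub>S\<^esub> fst q, snd q), (fst p, fst q))"
                  "\<lambda>(p, q). ((fst q, snd q \<otimes>\<^bsub>S\<^esub> snd p), (snd q, snd p))"])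
          (auto simp: factorisations_def m_assoc)
      also have "\<dots> = (\<Sum>p\<in>?P s. \<Sum>q\<in>?P (snd p). f (fst p) * g (fst q) * h (snd q))"
        by (rule sum.Sigma[symmetric]) (auto simp: P)
      also have "\<dots> = (f \<otimes>\<^bsub>?A\<^esub> (g \<otimes>\<^bsub>?A\<^esub> h)) s"
        by (simp add: semigroup_algebra_mult sum_distrib_left mult.assoc)
      finally show "((f \<otimes>\<^bsub>?A\<^esub> g) \<otimes>\<^bsub>?A\<^esub> h) s = (f \<otimes>\<^bsub>?A\<^esub> (g \<otimes>\<^bsub>?A\<^esub> h)) s" .
    qed
    show "\<one>\<^bsub>?A\<^esub> \<otimes>\<^bsub>?A\<^esub> f = f" if f: "f \<in> carrier ?A" for f
    proof
      fix s
      have "(\<one>\<^bsub>?A\<^esub> \<otimes>\<^bsub>?A\<^esub> f) s = (\<Sum>p\<in>?P s. if p = (\<one>\<^bsub>S\<^esub>, s) then f s else 0)"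
        by (auto simp: semigroup_algebra_mult factorisations_def intro!: sum.cong)
      also have "\<dots> = (if (\<one>\<^bsub>S\<^esub>, s) \<in> ?P s then f s else 0)"
        by (rule sum.delta) (rule P)
      also have "\<dots> = f s"
        using f by (auto simp: factorisations_def)
      finally show "(\<one>\<^bsub>?A\<^esub> \<otimes>\<^bsub>?A\<^esub> f) s = f s" .
    qed
    show "f \<otimes>\<^bsub>?A\<^esub> \<one>\<^bsub>?A\<^esub> = f" if f: "f \<in> carrier ?A" for f
    proof
      fix s
      have "(f \<otimes>\<^bsub>?A\<^esub> \<one>\<^bsub>?A\<^esub>) s = (\<Sum>p\<in>?P s. if p = (s, \<one>\<^bsub>S\<^esub>) then f s else 0)"
        by (auto simp: semigroup_algebra_mult factorisations_def intro!: sum.cong)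
      also have "\<dots> = (if (s, \<one>\<^bsub>S\<^esub>) \<in> ?P s then f s else 0)"
        by (rule sum.delta) (rule P)
      also have "\<dots> = f s"
        using f by (auto simp: factorisations_def)
      finally show "(f \<otimes>\<^bsub>?A\<^esub> \<one>\<^bsub>?A\<^esub>) s = f s" .
    qed
  qed
  show ?thesis
    by (rule ringI[OF ab mon])
      (auto simp: semigroup_algebra_mult fun_eq_iff sum.distrib[symmetric] algebra_simps intro!: sum.cong)
qed

section \<open>Left ideals of group algebras\<close>

text \<open>Linearity of the projection is stated for finite linear combinations, the form in which an
  average over a group uses it.\<close>

lemma subspace_projection:
  fixes I :: "('a \<Rightarrow> 'k::field) set"
  assumes zero: "(\<lambda>_. 0) \<in> I"
    and add: "\<And>f g. f \<in> I \<Longrightarrow> g \<in> I \<Longrightarrow> (\<lambda>x. f x + g x) \<in> I"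
    and scale: "\<And>c f. f \<in> I \<Longrightarrow> (\<lambda>x. c * f x) \<in> I"
  obtains p :: "('a \<Rightarrow> 'k) \<Rightarrow> 'a \<Rightarrow> 'k"
  where "\<And>f. p f \<in> I" "\<And>f. f \<in> I \<Longrightarrow> p f = f"
    and "\<And>(A :: 'b set) c v. finite A \<Longrightarrow>
      p (\<lambda>x. \<Sum>i\<in>A. c i * v i x) = (\<lambda>x. \<Sum>i\<in>A. c i * p (v i) x)"
proof -
  let ?s = "\<lambda>c (f :: 'a \<Rightarrow> 'k) x. c * f x"
  interpret vector_space_pair ?s ?s
    by unfold_locales (auto simp: fun_eq_iff algebra_simps)
  have "vs1.subspace I"
    using assms by (auto simp: vs1.subspace_def zero_fun_def plus_fun_def)
  moreover have "Vector_Spaces.linear ?s ?s id" by (rule vs1.linear_id)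
  ultimately obtain p where p: "range p \<subseteq> I" "Vector_Spaces.linear ?s ?s p" "\<forall>v\<in>I. p (id v) = v"
    using linear_exists_left_inverse_on[of id I] by auto
  interpret p: Vector_Spaces.linear ?s ?s p by fact
  have "p (\<lambda>x. \<Sum>i\<in>A. c i * v i x) = (\<lambda>x. \<Sum>i\<in>A. c i * p (v i) x)" if "finite A" for A :: "'b set" and c v
    using that
  proof (induction A rule: finite_induct)
    case empty
    show ?case using p.zero by (simp add: zero_fun_def)
  next
    case (insert i A)
    then have "p (\<lambda>x. \<Sum>i\<in>insert i A. c i * v i x) = p ((\<lambda>x. c i * v i x) + (\<lambda>x. \<Sum>i\<in>A. c i * v i x))"
      by (simp add: plus_fun_def)
    also have "\<dots> = (\<lambda>x. c i * p (v i) x) + p (\<lambda>x. \<Sum>i\<in>A. c i * v i x)"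
      by (simp only: p.add p.scale)
    finally show ?case using insert by (simp add: plus_fun_def)
  qed
  moreover have "p f \<in> I" for f using p(1) by blast
  ultimately show ?thesis using that[of p] p(3) by simp
qed

text \<open>This is Maschke's theorem: averaging a linear projection onto the left ideal \<open>I\<close> over the group
  gives a projection that commutes with left translations, hence is right multiplication by the
  image \<open>\<epsilon>\<close> of the unit.\<close>

lemma (in group) group_algebra_left_ideal_right_unit:
  fixes I :: "('a \<Rightarrow> 'k::field) set"
  assumes fin: "finite (carrier G)" and card: "of_nat (card (carrier G)) \<noteq> (0 :: 'k)"
    and supp: "\<And>f x. f \<in> I \<Longrightarrow> x \<notin> carrier G \<Longrightarrow> f x = 0"
    and zero: "(\<lambda>_. 0) \<in> I"
    and add: "\<And>f g. f \<in> I \<Longrightarrow> g \<in> I \<Longrightarrow> (\<lambda>x. f x + g x) \<in> I"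
    and scale: "\<And>c f. f \<in> I \<Longrightarrow> (\<lambda>x. c * f x) \<in> I"
    and translate: "\<And>g f. g \<in> carrier G \<Longrightarrow> f \<in> I \<Longrightarrow>
      (\<lambda>h. if h \<in> carrier G then f (inv g \<otimes> h) else 0) \<in> I"
  shows "\<exists>\<epsilon>\<in>I. \<forall>f\<in>I. \<forall>h\<in>carrier G. f h = (\<Sum>x\<in>carrier G. f x * \<epsilon> (inv x \<otimes> h))"
proof -
  obtain p :: "('a \<Rightarrow> 'k) \<Rightarrow> 'a \<Rightarrow> 'k" where
    p: "\<And>f. p f \<in> I" "\<And>f. f \<in> I \<Longrightarrow> p f = f" and
    lin: "\<And>(A :: 'a set) c v. finite A \<Longrightarrow>
      p (\<lambda>x. \<Sum>i\<in>A. c i * v i x) = (\<lambda>x. \<Sum>i\<in>A. c i * p (v i) x)"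
    using subspace_projection[OF zero add scale] by blast
  define L where "L g f = (\<lambda>h. if h \<in> carrier G then f (inv g \<otimes> h) else (0::'k))" for g f
  define \<delta> :: "'a \<Rightarrow> 'a \<Rightarrow> 'k" where "\<delta> g h = (if h = g then 1 else 0)" for g h
  define \<epsilon> where "\<epsilon> h = inverse (of_nat (card (carrier G))) * (\<Sum>g\<in>carrier G. L g (p (\<delta> (inv g))) h)" for h
  have sumI: "(\<lambda>h. \<Sum>g\<in>A. F g h) \<in> I" if "finite A" "\<And>g. g \<in> A \<Longrightarrow> F g \<in> I" for A :: "'a set" and F
    using that by (induction A rule: finite_induct) (auto intro: zero add)
  have "\<epsilon> \<in> I"
    unfolding \<epsilon>_def using fin p(1) translate unfolding L_def by (intro scale sumI) auto
  moreover have "f h = (\<Sum>x\<in>carrier G. f x * \<epsilon> (inv x \<otimes> h))" if f: "f \<in> I" and h: "h \<in> carrier G" for f h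
  proof -
    have expand: "L (inv k) f = (\<lambda>y. \<Sum>x\<in>carrier G. f x * \<delta> (inv k \<otimes> x) y)" if k: "k \<in> carrier G" for k
    proof
      fix y
      have "(\<Sum>x\<in>carrier G. f x * \<delta> (inv k \<otimes> x) y) = (\<Sum>x\<in>carrier G. if x = k \<otimes> y then L (inv k) f y else 0)"
        using k inv_solve_left' by (intro sum.cong) (auto simp: \<delta>_def L_def inv_solve_left m_assoc[symmetric])
      also have "\<dots> = L (inv k) f y"
        using k fin by (auto simp: sum.delta L_def)
      finally show "L (inv k) f y = (\<Sum>x\<in>carrier G. f x * \<delta> (inv k \<otimes> x) y)" by simp
    qed
    have "(\<Sum>x\<in>carrier G. f x * (\<Sum>g\<in>carrier G. L g (p (\<delta> (inv g))) (inv x \<otimes> h)))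
      = (\<Sum>x\<in>carrier G. \<Sum>g\<in>carrier G. f x * p (\<delta> (inv g)) (inv g \<otimes> (inv x \<otimes> h)))"
      using h by (auto simp: sum_distrib_left L_def intro!: sum.cong)
    also have "\<dots> = (\<Sum>x\<in>carrier G. \<Sum>k\<in>carrier G. f x * p (\<delta> (inv k \<otimes> x)) (inv k \<otimes> h))"
    proof (rule sum.cong[OF refl])
      fix x assume x: "x \<in> carrier G"
      show "(\<Sum>g\<in>carrier G. f x * p (\<delta> (inv g)) (inv g \<otimes> (inv x \<otimes> h)))
        = (\<Sum>k\<in>carrier G. f x * p (\<delta> (inv k \<otimes> x)) (inv k \<otimes> h))"
        by (rule sum.reindex_bij_witness[of _ "\<lambda>k. inv x \<otimes> k" "\<lambda>g. x \<otimes> g"])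
          (use x h in \<open>auto simp: m_assoc[symmetric] inv_mult_group\<close>, auto simp: m_assoc)
    qed
    also have "\<dots> = (\<Sum>k\<in>carrier G. \<Sum>x\<in>carrier G. f x * p (\<delta> (inv k \<otimes> x)) (inv k \<otimes> h))"
      by (rule sum.swap)
    also have "\<dots> = (\<Sum>k\<in>carrier G. p (L (inv k) f) (inv k \<otimes> h))"
      by (rule sum.cong) (simp_all add: expand lin[OF fin])
    also have "\<dots> = (\<Sum>k\<in>carrier G. f h)"
    proof (rule sum.cong[OF refl])
      fix k assume k: "k \<in> carrier G"
      have "p (L (inv k) f) = L (inv k) f"
        using translate[OF inv_closed[OF k] f] by (intro p(2)) (simp add: L_def)
      then show "p (L (inv k) f) (inv k \<otimes> h) = f h"
        using k h by (simp add: L_def m_assoc[symmetric])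
    qed
    finally show ?thesis
      using card by (simp add: \<epsilon>_def sum_distrib_left[symmetric] mult.left_commute[of "f _"])
  qed
  ultimately show ?thesis by blast
qed

section \<open>Regular star-monoids with a left-factor-closed submonoid\<close>

text \<open>The model to keep in mind is the partition monoid with \<open>\<star>\<close> turning a partition upside down and
  \<open>S\<close> the full-domain partitions. Since a left factor of an element of \<open>S\<close> lies in \<open>S\<close>, all
  projections \<open>x x\<^sup>\<star>\<close> with \<open>x \<in> S\<close> lie in \<open>J = S \<inter> S\<^sup>\<star>\<close>, and since these commute, \<open>J\<close> is an inverse
  monoid.\<close>

locale star_submonoid = monoid T for T :: "('a, 'm) monoid_scheme" (structure) +
  fixes star :: "'a \<Rightarrow> 'a"  (\<open>_\<^sup>\<star>\<close> [1000] 1000)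
    and S :: "'a set"
  assumes finite_carrier: "finite (carrier T)"
    and star_closed [simp, intro]: "x \<in> carrier T \<Longrightarrow> x\<^sup>\<star> \<in> carrier T"
    and star_star [simp]: "x \<in> carrier T \<Longrightarrow> x\<^sup>\<star>\<^sup>\<star> = x"
    and star_mult: "x \<in> carrier T \<Longrightarrow> y \<in> carrier T \<Longrightarrow> (x \<otimes> y)\<^sup>\<star> = y\<^sup>\<star> \<otimes> x\<^sup>\<star>"
    and regular: "x \<in> carrier T \<Longrightarrow> x \<otimes> (x\<^sup>\<star> \<otimes> x) = x"
    and S_subset: "S \<subseteq> carrier T"
    and one_in_S: "\<one> \<in> S"
    and mult_in_S: "x \<in> S \<Longrightarrow> y \<in> S \<Longrightarrow> x \<otimes> y \<in> S"
    and left_factor: "x \<in> carrier T \<Longrightarrow> y \<in> carrier T \<Longrightarrow> x \<otimes> y \<in> S \<Longrightarrow> x \<in> S"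
    and projections_commute: "x \<in> S \<Longrightarrow> y \<in> S \<Longrightarrow>
      (x \<otimes> x\<^sup>\<star>) \<otimes> (y \<otimes> y\<^sup>\<star>) = (y \<otimes> y\<^sup>\<star>) \<otimes> (x \<otimes> x\<^sup>\<star>)"
begin

definition J :: "'a set" where
  "J = {x \<in> S. x\<^sup>\<star> \<in> S}"

abbreviation alg :: "('k::field, 'a \<Rightarrow> 'k) module" where
  "alg \<equiv> semigroup_algebra (T\<lparr>carrier := S\<rparr>)"

abbreviation subalg :: "('k::field, 'a \<Rightarrow> 'k) module" where
  "subalg \<equiv> semigroup_algebra (T\<lparr>carrier := J\<rparr>)"

text \<open>The arrows of the groupoid of \<open>J\<close> are the elements \<open>b\<close> of \<open>J\<close>, running between the projections
  \<open>b b\<^sup>\<star>\<close> and \<open>b\<^sup>\<star> b\<close>. An element \<open>x\<close> of \<open>S\<close> is sent to the sum of those of its restrictions \<open>x e\<close>,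
  \<open>e\<close> a projection, that are elements \<open>b\<close> of \<open>J\<close> with \<open>b\<^sup>\<star> b = e\<close>. The value below is the coefficient
  of the arrow \<open>b\<close> in the image of \<open>a\<close>.\<close>

definition groupoid_map :: "('a \<Rightarrow> 'k::field) \<Rightarrow> 'a \<Rightarrow> 'k" where
  "groupoid_map a b = (\<Sum>x | x \<in> S \<and> x \<otimes> (b\<^sup>\<star> \<otimes> b) = b. a x)"

text \<open>The size of the left ideal \<open>T x\<close> plays the role of a rank. It is strictly monotone for the
  natural partial order of \<open>J\<close>, and it drops whenever a left multiplication leaves the
  \<open>L\<close>-class of \<open>x\<close>.\<close>

definition ideal_size :: "'a \<Rightarrow> nat" where
  "ideal_size x = card ((\<lambda>t. t \<otimes> x) ` carrier T)"

definition groupoid_kernel :: "('a \<Rightarrow> 'k::field) set" where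
  "groupoid_kernel = {a \<in> carrier alg. \<forall>b\<in>J. groupoid_map a b = 0}"

lemma S_carrier [simp, intro]: "x \<in> S \<Longrightarrow> x \<in> carrier T"
  using S_subset by blast

lemma JI: "x \<in> S \<Longrightarrow> x\<^sup>\<star> \<in> S \<Longrightarrow> x \<in> J"
  by (simp add: J_def)

lemma J_star [simp, intro]: "x \<in> J \<Longrightarrow> x\<^sup>\<star> \<in> J"
  by (simp add: J_def)

lemma J_mult: "x \<in> J \<Longrightarrow> y \<in> J \<Longrightarrow> x \<otimes> y \<in> J"
  by (simp add: J_def mult_in_S star_mult)

lemma J_S [simp, intro]: "x \<in> J \<Longrightarrow> x \<in> S"
  by (simp add: J_def)

lemma finite_S [simp]: "finite S"
  using finite_carrier S_subset finite_subset by blast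

lemma finite_J [simp]: "finite J"
  by (rule finite_subset[OF _ finite_S]) auto

lemma one_star: "\<one>\<^sup>\<star> = \<one>"
  using star_star[of "\<one>"] star_mult[of "\<one>" "\<one>\<^sup>\<star>"] by simp

lemma one_in_J: "\<one> \<in> J"
  by (rule JI) (simp_all add: one_in_S one_star)

lemma regular_star: "x \<in> carrier T \<Longrightarrow> x\<^sup>\<star> \<otimes> (x \<otimes> x\<^sup>\<star>) = x\<^sup>\<star>"
  using regular[of "x\<^sup>\<star>"] by simp

lemma regular_left: "x \<in> carrier T \<Longrightarrow> y \<in> carrier T \<Longrightarrow> x \<otimes> (x\<^sup>\<star> \<otimes> (x \<otimes> y)) = x \<otimes> y"
  using regular[of x] m_assoc[of x "x\<^sup>\<star> \<otimes> x" y] by (simp add: m_assoc)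

lemma regular_star_left: "x \<in> carrier T \<Longrightarrow> y \<in> carrier T \<Longrightarrow> x\<^sup>\<star> \<otimes> (x \<otimes> (x\<^sup>\<star> \<otimes> y)) = x\<^sup>\<star> \<otimes> y"
  using regular_left[of "x\<^sup>\<star>" y] by simp

lemmas star_simps = m_assoc star_mult regular regular_star regular_left regular_star_left

lemma projection_in_J: "x \<in> S \<Longrightarrow> x \<otimes> x\<^sup>\<star> \<in> J"
  using left_factor[of "x \<otimes> x\<^sup>\<star>" x] by (intro JI) (simp_all add: star_simps)

lemma alg_ring: "ring (alg :: ('k::field, 'a \<Rightarrow> 'k) module)"
proof (rule semigroup_algebra_ring)
  show "monoid (T\<lparr>carrier := S\<rparr>)"
    by (rule monoidI) (auto simp: one_in_S mult_in_S m_assoc)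
qed simp

lemma subalg_ring: "ring (subalg :: ('k::field, 'a \<Rightarrow> 'k) module)"
proof (rule semigroup_algebra_ring)
  show "monoid (T\<lparr>carrier := J\<rparr>)"
    by (rule monoidI) (auto simp: one_in_J J_mult m_assoc)
qed simp

section \<open>The homomorphism to the groupoid algebra\<close>

text \<open>Here \<open>d\<close> lies in \<open>J\<close> because \<open>d\<^sup>\<star>\<close> is a left factor of \<open>b\<^sup>\<star> = d\<^sup>\<star> t\<^sup>\<star>\<close>, an element of \<open>S\<close>.\<close>

lemma right_part:
  assumes b: "b \<in> J" and t: "t \<in> S" and u: "u \<in> S" and eq: "t \<otimes> u \<otimes> (b\<^sup>\<star> \<otimes> b) = b"
  defines "d \<equiv> u \<otimes> (b\<^sup>\<star> \<otimes> b)"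
  shows "d \<in> J" "t \<otimes> d = b" "d\<^sup>\<star> \<otimes> d = b\<^sup>\<star> \<otimes> b" "b \<otimes> u\<^sup>\<star> = b \<otimes> d\<^sup>\<star>"
proof -
  note c [simp] = S_carrier[OF t] S_carrier[OF u] S_carrier[OF J_S[OF b]]
  have dS: "d \<in> S" unfolding d_def using b u by (simp add: mult_in_S)
  note [simp] = S_carrier[OF dS]
  show td: "t \<otimes> d = b" using eq by (simp add: d_def m_assoc)
  have "d\<^sup>\<star> \<otimes> t\<^sup>\<star> \<in> S" using b by (simp add: star_mult[symmetric] td)
  then have "d\<^sup>\<star> \<in> S" by (rule left_factor[rotated 2]) auto
  with dS show "d \<in> J" by (rule JI)
  have "b \<otimes> (d\<^sup>\<star> \<otimes> d) = t \<otimes> (d \<otimes> (d\<^sup>\<star> \<otimes> d))"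
    by (simp add: td[symmetric] m_assoc)
  also have "\<dots> = b" by (simp add: regular td)
  finally have "(b\<^sup>\<star> \<otimes> (b \<otimes> (d\<^sup>\<star> \<otimes> d)))\<^sup>\<star> = (b\<^sup>\<star> \<otimes> b)\<^sup>\<star>" by simp
  then have "d\<^sup>\<star> \<otimes> (d \<otimes> (b\<^sup>\<star> \<otimes> b)) = b\<^sup>\<star> \<otimes> b" by (simp add: star_mult m_assoc)
  moreover have "d \<otimes> (b\<^sup>\<star> \<otimes> b) = d" by (simp add: d_def star_simps)
  ultimately show "d\<^sup>\<star> \<otimes> d = b\<^sup>\<star> \<otimes> b" by simp
  show "b \<otimes> u\<^sup>\<star> = b \<otimes> d\<^sup>\<star>" by (simp add: d_def star_simps)
qed

lemma middle_in_J:
  assumes b: "b \<in> J" and t: "t \<in> S" and u: "u \<in> S" and eq: "t \<otimes> u \<otimes> (b\<^sup>\<star> \<otimes> b) = b"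
  shows "b \<otimes> u\<^sup>\<star> \<in> J" "(b \<otimes> u\<^sup>\<star>) \<otimes> (b \<otimes> u\<^sup>\<star>)\<^sup>\<star> = b \<otimes> b\<^sup>\<star>"
proof -
  note c [simp] = S_carrier[OF t] S_carrier[OF u] S_carrier[OF J_S[OF b]]
  define d where "d = u \<otimes> (b\<^sup>\<star> \<otimes> b)"
  note d = right_part[OF assms, folded d_def]
  note [simp] = S_carrier[OF J_S[OF d(1)]]
  show "b \<otimes> u\<^sup>\<star> \<in> J" unfolding d(4) using b d(1) by (simp add: J_mult)
  have "(b \<otimes> d\<^sup>\<star>) \<otimes> (b \<otimes> d\<^sup>\<star>)\<^sup>\<star> = b \<otimes> ((d\<^sup>\<star> \<otimes> d) \<otimes> b\<^sup>\<star>)" by (simp add: star_mult m_assoc)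
  also have "\<dots> = b \<otimes> b\<^sup>\<star>" by (simp add: d(3) star_simps)
  finally show "(b \<otimes> u\<^sup>\<star>) \<otimes> (b \<otimes> u\<^sup>\<star>)\<^sup>\<star> = b \<otimes> b\<^sup>\<star>" unfolding d(4) .
qed

text \<open>The arrow \<open>b\<close> factors in the groupoid as \<open>g\<close> followed by \<open>g\<^sup>\<star> b\<close>, for each \<open>g\<close> with
  \<open>g g\<^sup>\<star> = b b\<^sup>\<star>\<close>. A product \<open>t u\<close> restricting to \<open>b\<close> picks out the single such \<open>g = b u\<^sup>\<star>\<close>, and then
  \<open>t\<close> restricts to \<open>g\<close> and \<open>u\<close> to \<open>g\<^sup>\<star> b\<close>.\<close>

lemma factorisation_iff:
  assumes b: "b \<in> J" and t: "t \<in> S" and u: "u \<in> S"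
    and g: "g \<in> J" "g \<otimes> g\<^sup>\<star> = b \<otimes> b\<^sup>\<star>"
  shows "t \<otimes> u \<otimes> (b\<^sup>\<star> \<otimes> b) = b \<and> b \<otimes> u\<^sup>\<star> = g \<longleftrightarrow>
    t \<otimes> (g\<^sup>\<star> \<otimes> g) = g \<and> u \<otimes> ((g\<^sup>\<star> \<otimes> b)\<^sup>\<star> \<otimes> (g\<^sup>\<star> \<otimes> b)) = g\<^sup>\<star> \<otimes> b"
    (is "?L \<longleftrightarrow> ?R")
proof -
  note c [simp] = S_carrier[OF t] S_carrier[OF u] S_carrier[OF J_S[OF b]] S_carrier[OF J_S[OF g(1)]]
  have "(g\<^sup>\<star> \<otimes> b)\<^sup>\<star> \<otimes> (g\<^sup>\<star> \<otimes> b) = b\<^sup>\<star> \<otimes> ((g \<otimes> g\<^sup>\<star>) \<otimes> b)" by (simp add: star_mult m_assoc)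
  then have bb: "(g\<^sup>\<star> \<otimes> b)\<^sup>\<star> \<otimes> (g\<^sup>\<star> \<otimes> b) = b\<^sup>\<star> \<otimes> b" by (simp add: g(2) star_simps)
  have "g \<otimes> (g\<^sup>\<star> \<otimes> b) = (g \<otimes> g\<^sup>\<star>) \<otimes> b" by (simp add: m_assoc)
  then have ggb: "g \<otimes> (g\<^sup>\<star> \<otimes> b) = b" by (simp add: g(2) star_simps)
  show ?thesis
  proof
    assume L: ?L
    define d where "d = u \<otimes> (b\<^sup>\<star> \<otimes> b)"
    note d = right_part[OF b t u conjunct1[OF L], folded d_def]
    note [simp] = S_carrier[OF J_S[OF d(1)]]
    have gd: "g = b \<otimes> d\<^sup>\<star>" using L d(4) by simp
    have "g\<^sup>\<star> \<otimes> b = d \<otimes> (b\<^sup>\<star> \<otimes> b)" by (simp add: gd star_mult m_assoc)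
    also have "\<dots> = d" by (simp add: d_def star_simps)
    finally have gb: "g\<^sup>\<star> \<otimes> b = d" .
    have "t \<otimes> (g\<^sup>\<star> \<otimes> g) = t \<otimes> ((g\<^sup>\<star> \<otimes> b) \<otimes> d\<^sup>\<star>)" by (simp add: gd m_assoc star_mult)
    also have "\<dots> = (t \<otimes> d) \<otimes> d\<^sup>\<star>" by (simp add: gb m_assoc)
    finally have "t \<otimes> (g\<^sup>\<star> \<otimes> g) = g" by (simp add: d(2) gd)
    moreover have "u \<otimes> (b\<^sup>\<star> \<otimes> b) = g\<^sup>\<star> \<otimes> b" by (simp add: gb d_def)
    ultimately show ?R unfolding bb by (rule conjI)
  next
    assume R: ?R
    then have uf: "u \<otimes> (b\<^sup>\<star> \<otimes> b) = g\<^sup>\<star> \<otimes> b" by (simp add: bb)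
    have "t \<otimes> u \<otimes> (b\<^sup>\<star> \<otimes> b) = t \<otimes> (g\<^sup>\<star> \<otimes> (g \<otimes> (g\<^sup>\<star> \<otimes> b)))"
      by (simp add: m_assoc uf star_simps)
    also have "\<dots> = (t \<otimes> (g\<^sup>\<star> \<otimes> g)) \<otimes> (g\<^sup>\<star> \<otimes> b)" by (simp add: m_assoc)
    also have "\<dots> = b" using R by (simp add: ggb)
    finally have tu: "t \<otimes> u \<otimes> (b\<^sup>\<star> \<otimes> b) = b" .
    have "b \<otimes> u\<^sup>\<star> = b \<otimes> (u \<otimes> (b\<^sup>\<star> \<otimes> b))\<^sup>\<star>" by (simp add: star_simps)
    also have "\<dots> = (b \<otimes> b\<^sup>\<star>) \<otimes> g" by (simp add: uf star_mult m_assoc)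
    also have "\<dots> = g" by (simp add: g(2)[symmetric] star_simps)
    finally show ?L using tu by simp
  qed
qed

text \<open>Multiplicativity: the right-hand side is the product in the groupoid algebra.\<close>

lemma groupoid_map_mult:
  fixes a a' :: "'a \<Rightarrow> 'k::field"
  assumes b: "b \<in> J"
  shows "groupoid_map (a \<otimes>\<^bsub>alg\<^esub> a') b =
    (\<Sum>g | g \<in> J \<and> g \<otimes> g\<^sup>\<star> = b \<otimes> b\<^sup>\<star>. groupoid_map a g * groupoid_map a' (g\<^sup>\<star> \<otimes> b))"
proof -
  let ?R = "{g \<in> J. g \<otimes> g\<^sup>\<star> = b \<otimes> b\<^sup>\<star>}"
  let ?Q = "{p \<in> S \<times> S. fst p \<otimes> snd p \<otimes> (b\<^sup>\<star> \<otimes> b) = b}"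
  let ?F = "\<lambda>p. a (fst p) * a' (snd p)"
  have finQ: "finite ?Q" by simp
  have "groupoid_map (a \<otimes>\<^bsub>alg\<^esub> a') b =
      (\<Sum>s\<in>{s \<in> S. s \<otimes> (b\<^sup>\<star> \<otimes> b) = b}. \<Sum>p\<in>{p \<in> ?Q. fst p \<otimes> snd p = s}. ?F p)"
    unfolding groupoid_map_def semigroup_algebra_mult
    by (intro sum.cong) (auto simp: factorisations_def)
  also have "\<dots> = (\<Sum>p\<in>?Q. ?F p)"
    by (rule sum.group) (auto intro: mult_in_S)
  also have "\<dots> = (\<Sum>g\<in>?R. \<Sum>p\<in>{p \<in> ?Q. b \<otimes> (snd p)\<^sup>\<star> = g}. ?F p)"
    by (rule sum.group[symmetric]) (use middle_in_J[OF b] in auto)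
  also have "\<dots> = (\<Sum>g\<in>?R. groupoid_map a g * groupoid_map a' (g\<^sup>\<star> \<otimes> b))"
  proof (rule sum.cong[OF refl])
    fix g assume "g \<in> ?R"
    then have g: "g \<in> J" "g \<otimes> g\<^sup>\<star> = b \<otimes> b\<^sup>\<star>" by auto
    have "{p \<in> ?Q. b \<otimes> (snd p)\<^sup>\<star> = g} = {t \<in> S. t \<otimes> (g\<^sup>\<star> \<otimes> g) = g} \<times>
        {u \<in> S. u \<otimes> ((g\<^sup>\<star> \<otimes> b)\<^sup>\<star> \<otimes> (g\<^sup>\<star> \<otimes> b)) = g\<^sup>\<star> \<otimes> b}" (is "?Q' = ?M \<times> ?U")
    proof (rule Set.set_eqI)
      fix p
      show "p \<in> ?Q' \<longleftrightarrow> p \<in> ?M \<times> ?U"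
        using factorisation_iff[OF b _ _ g, of "fst p" "snd p"] by (cases p) auto
    qed
    then show "(\<Sum>p\<in>?Q'. ?F p) = groupoid_map a g * groupoid_map a' (g\<^sup>\<star> \<otimes> b)"
      by (simp add: groupoid_map_def sum_product sum.cartesian_product case_prod_beta)
  qed
  finally show ?thesis .
qed

section \<open>Triangularity on the inverse submonoid\<close>

lemma groupoid_map_add: "groupoid_map (\<lambda>s. a s + a' s) b = groupoid_map a b + groupoid_map a' b"
  by (simp add: groupoid_map_def sum.distrib)

lemma groupoid_map_diff: "groupoid_map (\<lambda>s. a s - a' s) b = groupoid_map a b - groupoid_map a' b"
  by (simp add: groupoid_map_def sum_subtractf)

lemma groupoid_map_scale: "groupoid_map (\<lambda>s. c * a s) b = c * groupoid_map a b"
  by (simp add: groupoid_map_def sum_distrib_left)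

lemma groupoid_map_sum: "groupoid_map (\<lambda>s. \<Sum>i\<in>I. a i s) b = (\<Sum>i\<in>I. groupoid_map (a i) b)"
  unfolding groupoid_map_def by (rule sum.swap)

lemma ideal_size_mult: 
  assumes "t \<in> carrier T" "x \<in> carrier T"
  shows "ideal_size (t \<otimes> x) \<le> ideal_size x"
    and "ideal_size (t \<otimes> x) = ideal_size x \<Longrightarrow> \<exists>r\<in>carrier T. x = r \<otimes> (t \<otimes> x)"
proof -
  have sub: "(\<lambda>s. s \<otimes> (t \<otimes> x)) ` carrier T \<subseteq> (\<lambda>s. s \<otimes> x) ` carrier T" (is "?A \<subseteq> ?B")
    using assms by (auto simp: m_assoc[symmetric])
  then show "ideal_size (t \<otimes> x) \<le> ideal_size x"
    unfolding ideal_size_def by (intro card_mono) (simp_all add: finite_carrier)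
  assume "ideal_size (t \<otimes> x) = ideal_size x"
  then have "?A = ?B"
    using sub by (intro card_subset_eq) (simp_all add: finite_carrier ideal_size_def)
  moreover have "x \<in> ?B" using assms by (intro image_eqI[of _ _ "\<one>"]) auto
  ultimately show "\<exists>r\<in>carrier T. x = r \<otimes> (t \<otimes> x)" by auto
qed

text \<open>The assumption says that \<open>b\<close> lies strictly below \<open>x\<close> in the natural partial order. Commuting
  projections give \<open>b = b x\<^sup>\<star> x\<close>, so \<open>T b\<close> is contained in \<open>T x\<close>; if they were equal, \<open>x\<close> would be
  fixed by the projection \<open>b\<^sup>\<star> b\<close>.\<close>

lemma ideal_size_less:
  assumes x: "x \<in> J" and b: "b \<in> J" and le: "x \<otimes> (b\<^sup>\<star> \<otimes> b) = b" and ne: "x \<noteq> b"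
  shows "ideal_size b < ideal_size x"
proof -
  note c [simp] = S_carrier[OF J_S[OF x]] S_carrier[OF J_S[OF b]]
  have comm: "(b\<^sup>\<star> \<otimes> b) \<otimes> (x\<^sup>\<star> \<otimes> x) = (x\<^sup>\<star> \<otimes> x) \<otimes> (b\<^sup>\<star> \<otimes> b)"
    using projections_commute[of "b\<^sup>\<star>" "x\<^sup>\<star>"] x b by simp
  have "(b \<otimes> x\<^sup>\<star>) \<otimes> x = (x \<otimes> (b\<^sup>\<star> \<otimes> b)) \<otimes> (x\<^sup>\<star> \<otimes> x)" unfolding le by (simp add: m_assoc)
  also have "\<dots> = x \<otimes> ((b\<^sup>\<star> \<otimes> b) \<otimes> (x\<^sup>\<star> \<otimes> x))" by (simp add: m_assoc)
  also have "\<dots> = x \<otimes> (b\<^sup>\<star> \<otimes> b)" unfolding comm by (simp add: star_simps)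
  also have "\<dots> = b" by (rule le)
  finally have bx: "(b \<otimes> x\<^sup>\<star>) \<otimes> x = b" .
  have "ideal_size b \<noteq> ideal_size x"
  proof
    assume "ideal_size b = ideal_size x"
    then obtain r where r: "r \<in> carrier T" "x = r \<otimes> b"
      using ideal_size_mult(2)[of "b \<otimes> x\<^sup>\<star>" x] bx by auto
    then have "x \<otimes> (b\<^sup>\<star> \<otimes> b) = x" by (simp add: star_simps)
    then show False using le ne by simp
  qed
  moreover have "ideal_size b \<le> ideal_size x"
    using ideal_size_mult(1)[of "b \<otimes> x\<^sup>\<star>" x] bx by simp
  ultimately show ?thesis by simp
qed

text \<open>On \<open>J\<close> the map is unitriangular for the natural partial order, hence bijective onto the groupoid
  algebra. Each arrow is hit by Moebius inversion: subtract from \<open>x\<close> the preimages of the arrows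
  below it.\<close>

lemma groupoid_map_basis:
  assumes "x \<in> J"
  shows "\<exists>a :: 'a \<Rightarrow> 'k::field. (\<forall>s. s \<notin> J \<longrightarrow> a s = 0) \<and>
    (\<forall>b\<in>J. groupoid_map a b = (if b = x then 1 else 0))"
  using assms
proof (induction "ideal_size x" arbitrary: x rule: less_induct)
  case less
  note x = \<open>x \<in> J\<close>
  let ?L = "{b \<in> J. x \<otimes> (b\<^sup>\<star> \<otimes> b) = b \<and> b \<noteq> x}"
  have "\<exists>a :: 'a \<Rightarrow> 'k. (\<forall>s. s \<notin> J \<longrightarrow> a s = 0) \<and>
      (\<forall>c\<in>J. groupoid_map a c = (if c = b then 1 else 0))" if "b \<in> ?L" for b
  proof (rule less.hyps)
    show "ideal_size b < ideal_size x" using that ideal_size_less[OF x, of b] by auto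
    show "b \<in> J" using that by simp
  qed
  then have "\<forall>b\<in>?L. \<exists>a :: 'a \<Rightarrow> 'k. (\<forall>s. s \<notin> J \<longrightarrow> a s = 0) \<and>
      (\<forall>c\<in>J. groupoid_map a c = (if c = b then 1 else 0))" by (rule ballI)
  from bchoice[OF this] obtain D :: "'a \<Rightarrow> 'a \<Rightarrow> 'k" where
    D0: "\<forall>b\<in>?L. (\<forall>s. s \<notin> J \<longrightarrow> D b s = 0) \<and>
      (\<forall>c\<in>J. groupoid_map (D b) c = (if c = b then 1 else 0))" by (rule exE)
  have D: "\<And>b s. b \<in> ?L \<Longrightarrow> s \<notin> J \<Longrightarrow> D b s = 0"
    "\<And>b c. b \<in> ?L \<Longrightarrow> c \<in> J \<Longrightarrow> groupoid_map (D b) c = (if c = b then 1 else 0)"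
    using D0 by blast+
  let ?\<delta> = "\<lambda>s. if s = x then 1 else (0 :: 'k)"
  let ?a = "\<lambda>s. ?\<delta> s - (\<Sum>b\<in>?L. D b s)"
  have "groupoid_map ?a c = (if c = x then 1 else 0)" if c: "c \<in> J" for c
  proof -
    have "groupoid_map ?\<delta> c = (if x \<otimes> (c\<^sup>\<star> \<otimes> c) = c then 1 else 0)"
      using x by (simp add: groupoid_map_def sum.delta)
    moreover have "(\<Sum>b\<in>?L. groupoid_map (D b) c) = (\<Sum>b\<in>?L. if c = b then 1 else 0)"
      using D(2) c by (intro sum.cong) auto
    moreover have "(\<Sum>b\<in>?L. if c = b then 1 else (0 :: 'k)) = (if c \<in> ?L then 1 else 0)"
      by (rule sum.delta') simp
    moreover have "x \<otimes> (x\<^sup>\<star> \<otimes> x) = x" using x by (simp add: regular)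
    ultimately show ?thesis
      using c by (auto simp: groupoid_map_diff groupoid_map_sum)
  qed
  moreover have "?a s = 0" if "s \<notin> J" for s
    using that x D(1) by (auto intro: sum.neutral)
  ultimately show ?case by (intro exI[of _ ?a] conjI allI ballI impI)
qed

lemma groupoid_map_surj:
  fixes F :: "'a \<Rightarrow> 'k::field"
  obtains a where "a \<in> carrier subalg" "\<And>b. b \<in> J \<Longrightarrow> groupoid_map a b = F b"
proof -
  obtain D :: "'a \<Rightarrow> 'a \<Rightarrow> 'k" where D: "\<And>x s. x \<in> J \<Longrightarrow> s \<notin> J \<Longrightarrow> D x s = 0"
    "\<And>x b. x \<in> J \<Longrightarrow> b \<in> J \<Longrightarrow> groupoid_map (D x) b = (if b = x then 1 else 0)"
    using groupoid_map_basis by metis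
  let ?a = "\<lambda>s. \<Sum>x\<in>J. F x * D x s"
  have "groupoid_map ?a b = F b" if b: "b \<in> J" for b
  proof -
    have "groupoid_map ?a b = (\<Sum>x\<in>J. if b = x then F x else 0)"
      unfolding groupoid_map_sum groupoid_map_scale using D(2) b by (intro sum.cong) auto
    then show ?thesis using b by (simp add: sum.delta')
  qed
  moreover have "?a \<in> carrier subalg" using D(1) by (auto intro: sum.neutral)
  ultimately show ?thesis using that by blast
qed

text \<open>At a maximal element of the support no other term contributes to the coefficient.\<close>

lemma groupoid_map_inj:
  assumes a: "a \<in> carrier subalg" and zero: "\<And>b. b \<in> J \<Longrightarrow> groupoid_map a b = 0"
  shows "a = (\<lambda>_. 0)"
proof (rule ccontr)
  assume "a \<noteq> (\<lambda>_. 0)"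
  let ?B = "{b \<in> J. a b \<noteq> 0}"
  have "?B \<noteq> {}" using a \<open>a \<noteq> (\<lambda>_. 0)\<close> by fastforce
  then have "Max (ideal_size ` ?B) \<in> ideal_size ` ?B" by (intro Max_in) auto
  then obtain b where b: "b \<in> J" "a b \<noteq> 0" and bM: "ideal_size b = Max (ideal_size ` ?B)"
    by auto
  have max: "ideal_size x \<le> ideal_size b" if "x \<in> J" "a x \<noteq> 0" for x
    unfolding bM using that by (intro Max_ge) auto
  have "groupoid_map a b = (\<Sum>x\<in>{b}. a x)"
    unfolding groupoid_map_def
  proof (rule sum.mono_neutral_right)
    show "{b} \<subseteq> {x \<in> S. x \<otimes> (b\<^sup>\<star> \<otimes> b) = b}" using b by (auto simp: regular)
    show "\<forall>x\<in>{x \<in> S. x \<otimes> (b\<^sup>\<star> \<otimes> b) = b} - {b}. a x = 0"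
    proof
      fix x assume x: "x \<in> {x \<in> S. x \<otimes> (b\<^sup>\<star> \<otimes> b) = b} - {b}"
      show "a x = 0"
      proof (rule ccontr)
        assume ax: "a x \<noteq> 0"
        then have "x \<in> J" using a by auto
        then show False using ideal_size_less[OF _ b(1)] x max[OF _ ax] by fastforce
      qed
    qed
  qed simp
  then show False using zero[OF b(1)] b(2) by simp
qed

section \<open>The kernel is a nil ideal\<close>

lemma kernel_ideal: "ideal (groupoid_kernel :: ('a \<Rightarrow> 'k::field) set) alg"
proof (rule idealI)
  interpret A: ring "alg :: ('k, 'a \<Rightarrow> 'k) module" by (rule alg_ring)
  show "ring (alg :: ('k, 'a \<Rightarrow> 'k) module)" by (rule alg_ring)
  show "x \<otimes>\<^bsub>alg\<^esub> a \<in> groupoid_kernel" if "a \<in> groupoid_kernel" "x \<in> carrier alg" for a x :: "'a \<Rightarrow> 'k"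
  proof -
    have "g\<^sup>\<star> \<otimes> b \<in> J" if "b \<in> J" "g \<in> J" for b g using that by (simp add: J_mult)
    then show ?thesis
      using that A.m_closed[of x a] by (auto simp: groupoid_kernel_def groupoid_map_mult intro!: sum.neutral)
  qed
  show "a \<otimes>\<^bsub>alg\<^esub> x \<in> groupoid_kernel" if "a \<in> groupoid_kernel" "x \<in> carrier alg" for a x :: "'a \<Rightarrow> 'k"
    using that A.m_closed[of a x] by (auto simp: groupoid_kernel_def groupoid_map_mult intro!: sum.neutral)
  show "subgroup (groupoid_kernel :: ('a \<Rightarrow> 'k) set) (add_monoid alg)"
  proof (rule A.add.subgroupI)
    have "(\<lambda>_. 0) \<in> (groupoid_kernel :: ('a \<Rightarrow> 'k) set)" by (simp add: groupoid_kernel_def groupoid_map_def)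
    then show "(groupoid_kernel :: ('a \<Rightarrow> 'k) set) \<noteq> {}" by blast
    show "\<ominus>\<^bsub>alg\<^esub> a \<in> groupoid_kernel" if a: "a \<in> groupoid_kernel" for a :: "'a \<Rightarrow> 'k"
    proof -
      have "\<ominus>\<^bsub>alg\<^esub> a = (\<lambda>s. - 1 * a s)"
        using a by (intro A.minus_equality) (auto simp: groupoid_kernel_def)
      then show ?thesis
        using a groupoid_map_scale[of "- 1" a] by (simp add: groupoid_kernel_def)
    qed
    show "(groupoid_kernel :: ('a \<Rightarrow> 'k) set) \<subseteq> carrier alg" by (auto simp: groupoid_kernel_def)
    show "a \<oplus>\<^bsub>alg\<^esub> a' \<in> groupoid_kernel" if "a \<in> groupoid_kernel" "a' \<in> groupoid_kernel" for a a' :: "'a \<Rightarrow> 'k"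
      using that by (simp add: groupoid_kernel_def groupoid_map_add)
  qed
qed

text \<open>The sum is the coefficient of \<open>y\<close> in \<open>a x\<close>. If some \<open>s\<close> with \<open>s x = y\<close> exists, then by the
  hypothesis on sizes \<open>x\<close> and \<open>s x\<close> generate the same left ideal, so that \<open>b = s x x\<^sup>\<star>\<close> is in \<open>J\<close> and
  \<open>b\<^sup>\<star> b = x x\<^sup>\<star>\<close>. Now \<open>s' x = y\<close> holds iff \<open>s'\<close> restricts to \<open>b\<close>, so the sum is the coefficient of the
  arrow \<open>b\<close>.\<close>

lemma kernel_left_mult_vanishes:
  fixes a :: "'a \<Rightarrow> 'k::field"
  assumes a: "a \<in> groupoid_kernel" and x: "x \<in> S" and size: "ideal_size x \<le> ideal_size y"
  shows "(\<Sum>s | s \<in> S \<and> s \<otimes> x = y. a s) = 0"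
proof (cases "{s \<in> S. s \<otimes> x = y} = {}")
  case True
  then show ?thesis by (simp only: sum.empty)
next
  case False
  then obtain s where s: "s \<in> S" "s \<otimes> x = y" by auto
  note [simp] = S_carrier[OF x] S_carrier[OF s(1)]
  let ?e = "x \<otimes> x\<^sup>\<star>"
  define b where "b = s \<otimes> ?e"
  have eJ: "?e \<in> J" using x by (rule projection_in_J)
  have bS: "b \<in> S" using s(1) eJ by (simp add: b_def mult_in_S)
  note [simp] = S_carrier[OF bS]
  have "ideal_size (s \<otimes> x) = ideal_size x"
    using ideal_size_mult(1)[of s x] size s(2) by simp
  then obtain r where r: "r \<in> carrier T" "x = r \<otimes> (s \<otimes> x)"
    using ideal_size_mult(2)[of s x] by auto
  have "?e = (r \<otimes> (s \<otimes> x)) \<otimes> x\<^sup>\<star>" using r(2) by simp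
  then have erb: "?e = r \<otimes> b" using r(1) by (simp add: b_def m_assoc)
  have be: "b \<otimes> ?e = b" by (simp add: b_def star_simps)
  have "?e \<otimes> (b\<^sup>\<star> \<otimes> b) = ?e" unfolding erb using r(1) by (simp add: star_simps)
  then have "(?e \<otimes> (b\<^sup>\<star> \<otimes> b))\<^sup>\<star> = ?e\<^sup>\<star>" by simp
  then have "b\<^sup>\<star> \<otimes> (b \<otimes> ?e) = ?e" by (simp add: star_simps)
  then have bb: "b\<^sup>\<star> \<otimes> b = ?e" unfolding be .
  have "b\<^sup>\<star> \<otimes> b \<in> S" unfolding bb using eJ by simp
  then have "b\<^sup>\<star> \<in> S" by (rule left_factor[rotated 2]) auto
  with bS have bJ: "b \<in> J" by (rule JI)
  have "s' \<otimes> x = y \<longleftrightarrow> s' \<otimes> (b\<^sup>\<star> \<otimes> b) = b" if s': "s' \<in> S" for s'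
  proof
    assume "s' \<otimes> x = y"
    then have "(s' \<otimes> x) \<otimes> x\<^sup>\<star> = (s \<otimes> x) \<otimes> x\<^sup>\<star>" using s(2) by simp
    then show "s' \<otimes> (b\<^sup>\<star> \<otimes> b) = b" unfolding bb using s' by (simp add: b_def m_assoc)
  next
    assume "s' \<otimes> (b\<^sup>\<star> \<otimes> b) = b"
    then have "(s' \<otimes> ?e) \<otimes> x = (s \<otimes> ?e) \<otimes> x" unfolding bb by (simp add: b_def)
    then show "s' \<otimes> x = y" using s' s(2) by (simp add: star_simps)
  qed
  then have "{s' \<in> S. s' \<otimes> x = y} = {s' \<in> S. s' \<otimes> (b\<^sup>\<star> \<otimes> b) = b}" by auto
  then show ?thesis
    using a bJ by (simp add: groupoid_kernel_def groupoid_map_def)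
qed

text \<open>Every left multiplication by \<open>a\<close> lowers the ideal sizes occurring in the support.\<close>

lemma kernel_nil:
  fixes a :: "'a \<Rightarrow> 'k::field"
  assumes a: "a \<in> groupoid_kernel"
  shows "\<exists>n::nat. a [^]\<^bsub>alg\<^esub> n = \<zero>\<^bsub>alg\<^esub>"
proof -
  interpret A: ring "alg :: ('k, 'a \<Rightarrow> 'k) module" by (rule alg_ring)
  have ac: "a \<in> carrier alg" using a by (simp add: groupoid_kernel_def)
  have step: "\<exists>x. c x \<noteq> 0 \<and> ideal_size y < ideal_size x"
    if c: "c \<in> carrier alg" and y: "(a \<otimes>\<^bsub>alg\<^esub> c) y \<noteq> 0" for c y
  proof (rule ccontr)
    assume no: "\<not> ?thesis"
    have "(a \<otimes>\<^bsub>alg\<^esub> c) y = (\<Sum>x\<in>S. \<Sum>p\<in>{p \<in> factorisations (T\<lparr>carrier := S\<rparr>) y. snd p = x}. a (fst p) * c (snd p))"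
      unfolding semigroup_algebra_mult
      by (rule sum.group[symmetric]) (auto simp: finite_factorisations, auto simp: factorisations_def)
    also have "\<dots> = (\<Sum>x\<in>S. (\<Sum>s | s \<in> S \<and> s \<otimes> x = y. a s) * c x)"
    proof (rule sum.cong[OF refl])
      fix x assume "x \<in> S"
      then show "(\<Sum>p\<in>{p \<in> factorisations (T\<lparr>carrier := S\<rparr>) y. snd p = x}. a (fst p) * c (snd p))
          = (\<Sum>s | s \<in> S \<and> s \<otimes> x = y. a s) * c x"
        unfolding sum_distrib_right
        by (intro sum.reindex_bij_witness[of _ "\<lambda>s. (s, x)" fst]) (auto simp: factorisations_def)
    qed
    also have "\<dots> = 0"
    proof (rule sum.neutral, rule ballI)
      fix x assume x: "x \<in> S"
      show "(\<Sum>s | s \<in> S \<and> s \<otimes> x = y. a s) * c x = 0"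
      proof (cases "c x = 0")
        case False
        then have "ideal_size x \<le> ideal_size y" using no by force
        then show ?thesis using kernel_left_mult_vanishes[OF a x] by simp
      qed simp
    qed
    finally show False using y by simp
  qed
  have bound: "ideal_size y + n \<le> card (carrier T)" if "(a [^]\<^bsub>alg\<^esub> n) y \<noteq> 0" for n :: nat and y
    using that
  proof (induction n arbitrary: y)
    case 0
    have "ideal_size y \<le> card (carrier T)"
      unfolding ideal_size_def by (rule card_image_le[OF finite_carrier])
    then show ?case by simp
  next
    case (Suc n)
    have pc: "a [^]\<^bsub>alg\<^esub> n \<in> carrier alg" using ac by (rule A.nat_pow_closed)
    have "(a \<otimes>\<^bsub>alg\<^esub> a [^]\<^bsub>alg\<^esub> n) y \<noteq> 0"
      using Suc.prems A.nat_pow_Suc2[OF ac, of n] by simp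
    then obtain x where "(a [^]\<^bsub>alg\<^esub> n) x \<noteq> 0" "ideal_size y < ideal_size x"
      using step[OF pc] by blast
    then show ?case using Suc.IH[of x] by simp
  qed
  have "(a [^]\<^bsub>alg\<^esub> Suc (card (carrier T))) y = 0" for y
    using bound[of "Suc (card (carrier T))" y] by fastforce
  then have "a [^]\<^bsub>alg\<^esub> Suc (card (carrier T)) = \<zero>\<^bsub>alg\<^esub>"
    unfolding semigroup_algebra_simps by blast
  then show ?thesis by blast
qed

lemma kernel_le_radical: "(groupoid_kernel :: ('a \<Rightarrow> 'k::field) set) \<subseteq> jacobson_radical alg"
proof -
  interpret A: ring "alg :: ('k, 'a \<Rightarrow> 'k) module" by (rule alg_ring)
  interpret ideal "groupoid_kernel :: ('a \<Rightarrow> 'k) set" alg by (rule kernel_ideal)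
  have "left_ideal (groupoid_kernel :: ('a \<Rightarrow> 'k) set) alg"
    unfolding left_ideal_def using is_additive_subgroup I_l_closed by blast
  then show ?thesis
    by (rule A.nil_left_ideal_le_jacobson_radical) (rule kernel_nil)
qed

section \<open>The radical is contained in the kernel\<close>

lemma S_algI: "a \<in> carrier subalg \<Longrightarrow> a \<in> carrier alg"
  by auto

text \<open>The vertex group of the groupoid at a projection \<open>e\<close>, that is, the maximal subgroup of \<open>J\<close>
  with unit \<open>e\<close>.\<close>

definition loops :: "'a \<Rightarrow> 'a set" where
  "loops e = {h \<in> J. h \<otimes> h\<^sup>\<star> = e \<and> h\<^sup>\<star> \<otimes> h = e}"

lemma loops_group:
  assumes b: "b \<in> J"
  defines "e \<equiv> b\<^sup>\<star> \<otimes> b"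
  defines "H \<equiv> T\<lparr>carrier := loops e, one := e\<rparr>"
  shows "group H" and "h \<in> loops e \<Longrightarrow> inv\<^bsub>H\<^esub> h = h\<^sup>\<star>"
proof -
  have bc [simp]: "b \<in> carrier T" using b by auto
  have eJ: "e \<in> J" unfolding e_def using b by (simp add: J_mult)
  have ee: "e\<^sup>\<star> = e" "e \<otimes> e = e" by (simp_all add: e_def star_simps)
  have unit: "e \<otimes> h = h" "h \<otimes> e = h" if "h \<in> loops e" for h
  proof -
    have h: "h \<in> carrier T" "h \<otimes> h\<^sup>\<star> = e" "h\<^sup>\<star> \<otimes> h = e" using that by (auto simp: loops_def)
    show "e \<otimes> h = h" using h(1) by (simp add: h(2)[symmetric] star_simps)
    show "h \<otimes> e = h" using h(1) by (simp add: h(3)[symmetric] star_simps)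
  qed
  have closed: "h \<otimes> k \<in> loops e" if hk: "h \<in> loops e" "k \<in> loops e" for h k
  proof -
    have h: "h \<in> J" "h \<otimes> h\<^sup>\<star> = e" "h\<^sup>\<star> \<otimes> h = e" and k: "k \<in> J" "k \<otimes> k\<^sup>\<star> = e" "k\<^sup>\<star> \<otimes> k = e"
      using hk by (auto simp: loops_def)
    note [simp] = S_carrier[OF J_S[OF h(1)]] S_carrier[OF J_S[OF k(1)]] S_carrier[OF J_S[OF eJ]]
    have "(h \<otimes> k) \<otimes> (h \<otimes> k)\<^sup>\<star> = (h \<otimes> (k \<otimes> k\<^sup>\<star>)) \<otimes> h\<^sup>\<star>" by (simp add: star_mult m_assoc)
    also have "\<dots> = e" by (simp add: k(2) unit(2)[OF hk(1)] h(2))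
    finally have 1: "(h \<otimes> k) \<otimes> (h \<otimes> k)\<^sup>\<star> = e" .
    have "(h \<otimes> k)\<^sup>\<star> \<otimes> (h \<otimes> k) = k\<^sup>\<star> \<otimes> ((h\<^sup>\<star> \<otimes> h) \<otimes> k)" by (simp add: star_mult m_assoc)
    also have "\<dots> = e" by (simp add: h(3) unit(1)[OF hk(2)] k(3))
    finally show ?thesis using 1 h(1) k(1) by (simp add: loops_def J_mult)
  qed
  have star: "h\<^sup>\<star> \<in> loops e" "h\<^sup>\<star> \<otimes> h = e" if "h \<in> loops e" for h
    using that by (auto simp: loops_def)
  show G: "group H"
  proof (rule groupI)
    show "\<one>\<^bsub>H\<^esub> \<in> carrier H" using eJ ee by (simp add: H_def loops_def)
    show "x \<otimes>\<^bsub>H\<^esub> y \<otimes>\<^bsub>H\<^esub> z = x \<otimes>\<^bsub>H\<^esub> (y \<otimes>\<^bsub>H\<^esub> z)"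
      if "x \<in> carrier H" "y \<in> carrier H" "z \<in> carrier H" for x y z
      using that by (auto simp: H_def loops_def m_assoc)
    show "\<exists>y\<in>carrier H. y \<otimes>\<^bsub>H\<^esub> x = \<one>\<^bsub>H\<^esub>" if "x \<in> carrier H" for x
      using that star[of x] by (auto simp: H_def)
  qed (simp_all add: H_def closed unit)
  show "inv\<^bsub>H\<^esub> h = h\<^sup>\<star>" if "h \<in> loops e"
    using star[OF that] that by (intro group.inv_equality[OF G]) (simp_all add: H_def)
qed

text \<open>For a projection \<open>e\<close> with vertex group \<open>H\<close>, the coefficients at \<open>H\<close> of the elements of the radical
  form a left ideal \<open>I\<close> of the group algebra of \<open>H\<close>. By Maschke it has a right unit \<open>\<epsilon>\<close>. Lift \<open>\<epsilon>\<close> to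
  \<open>y\<close>, and let \<open>x\<close> be an element of the radical with \<open>H\<close>-part \<open>\<epsilon>\<close>. Then \<open>y x\<close> is in the radical, so
  \<open>1 - y x\<close> is left invertible, while \<open>(1 - y x) y\<close> is mapped to \<open>\<epsilon> - \<epsilon> = 0\<close>. Hence \<open>\<epsilon>\<close> vanishes, and
  so does \<open>I\<close>. A nonzero coefficient of an element of the radical at any arrow \<open>b\<close> can be moved to
  the vertex \<open>b\<^sup>\<star> b\<close> by a left multiplication.\<close>

lemma radical_le_kernel:
  assumes char: "\<And>b. b \<in> J \<Longrightarrow> of_nat (card (loops (b\<^sup>\<star> \<otimes> b))) \<noteq> (0 :: 'k::field)"
  shows "jacobson_radical alg \<subseteq> (groupoid_kernel :: ('a \<Rightarrow> 'k) set)"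
proof
  fix a :: "'a \<Rightarrow> 'k"
  assume a: "a \<in> jacobson_radical alg"
  interpret A: ring "alg :: ('k, 'a \<Rightarrow> 'k) module" by (rule alg_ring)
  let ?Rad = "jacobson_radical alg :: ('a \<Rightarrow> 'k) set"
  note rad = A.left_idealD[OF A.left_ideal_jacobson_radical]
  have "groupoid_map a b = 0" if b: "b \<in> J" for b
  proof (rule ccontr)
    assume nz: "groupoid_map a b \<noteq> 0"
    define e where "e = b\<^sup>\<star> \<otimes> b"
    let ?H = "loops e"
    interpret H: group "T\<lparr>carrier := ?H, one := e\<rparr>"
      unfolding e_def by (rule loops_group[OF b])
    have invH: "inv\<^bsub>T\<lparr>carrier := ?H, one := e\<rparr>\<^esub> h = h\<^sup>\<star>" if "h \<in> ?H" for h
      using loops_group(2)[OF b] that unfolding e_def by blast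
    have bc [simp]: "b \<in> carrier T" using b by auto
    have eJ: "e \<in> J" unfolding e_def using b by (simp add: J_mult)
    have ee: "e \<otimes> e\<^sup>\<star> = e" "e\<^sup>\<star> \<otimes> e = e" by (simp_all add: e_def star_simps)
    have eH: "e \<in> ?H" using eJ ee by (simp add: loops_def)
    have HJ: "h \<in> J" "h \<in> carrier T" "h \<otimes> h\<^sup>\<star> = e" "h\<^sup>\<star> \<otimes> h = e" if "h \<in> ?H" for h
      using that by (auto simp: loops_def)
    have starH: "h\<^sup>\<star> \<in> ?H" if "h \<in> ?H" for h using that by (auto simp: loops_def)
    have multH: "h \<otimes> k \<in> ?H" if "h \<in> ?H" "k \<in> ?H" for h k
      using H.m_closed that by simp
    \<comment> \<open>In the groupoid, an arrow of \<open>H\<close> composes on the left only with arrows \<open>d\<close> such that \<open>d d\<^sup>\<star> = e\<close>.\<close>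
    have corner: "groupoid_map (y \<otimes>\<^bsub>alg\<^esub> x) c =
        (if c \<otimes> c\<^sup>\<star> = e then \<Sum>h\<in>?H. F h * groupoid_map x (h\<^sup>\<star> \<otimes> c) else 0)"
      if y: "\<And>c. c \<in> J \<Longrightarrow> groupoid_map y c = F c" and F: "\<And>h. h \<notin> ?H \<Longrightarrow> F h = 0" and c: "c \<in> J"
      for x y :: "'a \<Rightarrow> 'k" and F c
    proof -
      have "groupoid_map (y \<otimes>\<^bsub>alg\<^esub> x) c =
          (\<Sum>h | h \<in> J \<and> h \<otimes> h\<^sup>\<star> = c \<otimes> c\<^sup>\<star>. F h * groupoid_map x (h\<^sup>\<star> \<otimes> c))"
        unfolding groupoid_map_mult[OF c] by (rule sum.cong) (auto simp: y)
      also have "\<dots> = (if c \<otimes> c\<^sup>\<star> = e then \<Sum>h\<in>?H. F h * groupoid_map x (h\<^sup>\<star> \<otimes> c) else 0)"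
      proof (cases "c \<otimes> c\<^sup>\<star> = e")
        case True
        have "(\<Sum>h | h \<in> J \<and> h \<otimes> h\<^sup>\<star> = c \<otimes> c\<^sup>\<star>. F h * groupoid_map x (h\<^sup>\<star> \<otimes> c))
            = (\<Sum>h\<in>?H. F h * groupoid_map x (h\<^sup>\<star> \<otimes> c))"
          by (rule sum.mono_neutral_right) (use True F in \<open>auto simp: loops_def\<close>)
        then show ?thesis using True by simp
      next
        case False
        then have "F h = 0" if "h \<otimes> h\<^sup>\<star> = c \<otimes> c\<^sup>\<star>" for h
          using that F HJ(3)[of h] by fastforce
        then show ?thesis using False by (auto intro: sum.neutral)
      qed
      finally show ?thesis .
    qed
    define I where "I = (\<lambda>x h. if h \<in> ?H then groupoid_map x h else 0) ` ?Rad"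
    have "\<exists>\<epsilon>\<in>I. \<forall>f\<in>I. \<forall>h\<in>carrier (T\<lparr>carrier := ?H, one := e\<rparr>).
        f h = (\<Sum>x\<in>carrier (T\<lparr>carrier := ?H, one := e\<rparr>). f x * \<epsilon> (inv\<^bsub>T\<lparr>carrier := ?H, one := e\<rparr>\<^esub> x \<otimes>\<^bsub>T\<lparr>carrier := ?H, one := e\<rparr>\<^esub> h))"
    proof (rule H.group_algebra_left_ideal_right_unit)
      show "finite (carrier (T\<lparr>carrier := ?H, one := e\<rparr>))" by (simp add: loops_def)
      show "of_nat (card (carrier (T\<lparr>carrier := ?H, one := e\<rparr>))) \<noteq> (0 :: 'k)"
        using char[OF b] by (simp add: e_def)
      show "f x = 0" if "f \<in> I" "x \<notin> carrier (T\<lparr>carrier := ?H, one := e\<rparr>)" for f x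
        using that by (auto simp: I_def)
      show "(\<lambda>_. 0) \<in> I"
        unfolding I_def by (rule image_eqI[OF _ rad(2)]) (auto simp: groupoid_map_def)
      show "(\<lambda>x. f x + g x) \<in> I" if f: "f \<in> I" and g: "g \<in> I" for f g
      proof -
        obtain x where x: "x \<in> ?Rad" "f = (\<lambda>h. if h \<in> ?H then groupoid_map x h else 0)"
          using f unfolding I_def by (rule imageE)
        obtain y where y: "y \<in> ?Rad" "g = (\<lambda>h. if h \<in> ?H then groupoid_map y h else 0)"
          using g unfolding I_def by (rule imageE)
        show ?thesis
          unfolding I_def
          by (rule image_eqI[OF _ rad(3)[OF x(1) y(1)]]) (auto simp: x(2) y(2) groupoid_map_add)
      qed
      show "(\<lambda>x. c * f x) \<in> I" if f: "f \<in> I" for c f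
      proof -
        obtain x where x: "x \<in> ?Rad" "f = (\<lambda>h. if h \<in> ?H then groupoid_map x h else 0)"
          using f unfolding I_def by (rule imageE)
        have xc: "x \<in> carrier alg" using x(1) rad(1) by blast
        let ?c = "\<lambda>s. c * (\<one>\<^bsub>alg\<^esub> :: 'a \<Rightarrow> 'k) s"
        have "?c \<otimes>\<^bsub>alg\<^esub> x = (\<lambda>s. c * (\<one>\<^bsub>alg\<^esub> \<otimes>\<^bsub>alg\<^esub> x) s)"
          by (simp only: semigroup_algebra_mult sum_distrib_left mult.assoc)
        then have "?c \<otimes>\<^bsub>alg\<^esub> x = (\<lambda>s. c * x s)" using A.l_one[OF xc] by simp
        moreover have "?c \<otimes>\<^bsub>alg\<^esub> x \<in> ?Rad"
          by (rule rad(4)[OF _ x(1)]) (use one_in_S in auto)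
        ultimately have "(\<lambda>s. c * x s) \<in> ?Rad" by simp
        from image_eqI[OF _ this] show ?thesis
          unfolding I_def by (rule meta_mp) (auto simp: x(2) groupoid_map_scale)
      qed
      show "(\<lambda>h. if h \<in> carrier (T\<lparr>carrier := ?H, one := e\<rparr>)
          then f (inv\<^bsub>T\<lparr>carrier := ?H, one := e\<rparr>\<^esub> g \<otimes>\<^bsub>T\<lparr>carrier := ?H, one := e\<rparr>\<^esub> h) else 0) \<in> I"
        if g: "g \<in> carrier (T\<lparr>carrier := ?H, one := e\<rparr>)" and f: "f \<in> I" for g f
      proof -
        have gH: "g \<in> ?H" using g by simp
        obtain x where x: "x \<in> ?Rad" "f = (\<lambda>h. if h \<in> ?H then groupoid_map x h else 0)"
          using f unfolding I_def by (rule imageE)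
        let ?F = "\<lambda>h. if h = g then 1 else 0 :: 'k"
        obtain y :: "'a \<Rightarrow> 'k" where y: "y \<in> carrier subalg" "\<And>c. c \<in> J \<Longrightarrow> groupoid_map y c = ?F c"
          using groupoid_map_surj[of ?F] by blast
        have Fsupp: "?F h = 0" if "h \<notin> ?H" for h using that gH by auto
        have "y \<otimes>\<^bsub>alg\<^esub> x \<in> ?Rad" by (rule rad(4)[OF S_algI[OF y(1)] x(1)])
        moreover have "f (g\<^sup>\<star> \<otimes> h) = groupoid_map (y \<otimes>\<^bsub>alg\<^esub> x) h" if h: "h \<in> ?H" for h
        proof -
          have "groupoid_map (y \<otimes>\<^bsub>alg\<^esub> x) h = (\<Sum>k\<in>?H. ?F k * groupoid_map x (k\<^sup>\<star> \<otimes> h))"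
            using corner[OF y(2) Fsupp HJ(1)[OF h], of x] HJ(3)[OF h] by simp
          also have "\<dots> = (\<Sum>k\<in>?H. if k = g then groupoid_map x (g\<^sup>\<star> \<otimes> h) else 0)"
            by (rule sum.cong) auto
          also have "\<dots> = groupoid_map x (g\<^sup>\<star> \<otimes> h)"
            using gH by (simp add: sum.delta loops_def)
          finally show ?thesis using multH[OF starH[OF gH] h] by (simp add: x(2))
        qed
        ultimately show ?thesis
          unfolding I_def by (intro image_eqI[of _ _ "y \<otimes>\<^bsub>alg\<^esub> x"]) (auto simp: invH[OF gH] fun_eq_iff)
      qed
    qed
    then obtain \<epsilon> where eps: "\<epsilon> \<in> I" and
      right_unit: "\<And>f h. f \<in> I \<Longrightarrow> h \<in> ?H \<Longrightarrow> f h = (\<Sum>x\<in>?H. f x * \<epsilon> (x\<^sup>\<star> \<otimes> h))"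
      by (auto simp: invH)
    obtain x where x: "x \<in> ?Rad" "\<epsilon> = (\<lambda>h. if h \<in> ?H then groupoid_map x h else 0)"
      using eps unfolding I_def by (rule imageE)
    have eps_supp: "\<epsilon> h = 0" if "h \<notin> ?H" for h using that x(2) by simp
    obtain y :: "'a \<Rightarrow> 'k" where y: "y \<in> carrier subalg" "\<And>c. c \<in> J \<Longrightarrow> groupoid_map y c = \<epsilon> c"
      using groupoid_map_surj[of \<epsilon>] by blast
    have yc: "y \<in> carrier alg" by (rule S_algI[OF y(1)])
    have yx: "y \<otimes>\<^bsub>alg\<^esub> x \<in> ?Rad" by (rule rad(4)[OF yc x(1)])
    then have yxc: "y \<otimes>\<^bsub>alg\<^esub> x \<in> carrier alg" using rad(1) by blast
    obtain z where z: "z \<in> carrier alg" "z \<otimes>\<^bsub>alg\<^esub> (\<one>\<^bsub>alg\<^esub> \<ominus>\<^bsub>alg\<^esub> (y \<otimes>\<^bsub>alg\<^esub> x)) = \<one>\<^bsub>alg\<^esub>"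
      using A.jacobson_radical_left_invertible[OF yx] by blast
    have yyx: "groupoid_map (y \<otimes>\<^bsub>alg\<^esub> x) h = \<epsilon> h" if h: "h \<in> ?H" for h
    proof -
      have "groupoid_map (y \<otimes>\<^bsub>alg\<^esub> x) h = (\<Sum>k\<in>?H. \<epsilon> k * groupoid_map x (k\<^sup>\<star> \<otimes> h))"
        using corner[OF y(2) eps_supp HJ(1)[OF h], of x] HJ(3)[OF h] by simp
      also have "\<dots> = (\<Sum>k\<in>?H. \<epsilon> k * \<epsilon> (k\<^sup>\<star> \<otimes> h))"
        by (rule sum.cong) (use multH starH h in \<open>auto simp: x(2)\<close>)
      also have "\<dots> = \<epsilon> h" by (rule right_unit[OF eps h, symmetric])
      finally show ?thesis .
    qed
    have yxy: "groupoid_map ((y \<otimes>\<^bsub>alg\<^esub> x) \<otimes>\<^bsub>alg\<^esub> y) c = \<epsilon> c" if c: "c \<in> J" for c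
    proof -
      have cc [simp]: "c \<in> carrier T" using c by auto
      let ?R = "{g \<in> J. g \<otimes> g\<^sup>\<star> = c \<otimes> c\<^sup>\<star>}"
      have "groupoid_map ((y \<otimes>\<^bsub>alg\<^esub> x) \<otimes>\<^bsub>alg\<^esub> y) c
          = (\<Sum>g\<in>?R. groupoid_map (y \<otimes>\<^bsub>alg\<^esub> x) g * \<epsilon> (g\<^sup>\<star> \<otimes> c))"
        unfolding groupoid_map_mult[OF c] by (rule sum.cong) (use c in \<open>auto simp: y(2) J_mult\<close>)
      also have "\<dots> = \<epsilon> c"
      proof (cases "c \<otimes> c\<^sup>\<star> = e")
        case False
        have "groupoid_map (y \<otimes>\<^bsub>alg\<^esub> x) g = 0" if "g \<in> ?R" for g
          using that False corner[OF y(2) eps_supp, of g x] by auto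
        moreover have "\<epsilon> c = 0" using False HJ(3) eps_supp by blast
        ultimately show ?thesis by simp
      next
        case True
        have "(\<Sum>g\<in>?R. groupoid_map (y \<otimes>\<^bsub>alg\<^esub> x) g * \<epsilon> (g\<^sup>\<star> \<otimes> c))
            = (\<Sum>g\<in>?H. groupoid_map (y \<otimes>\<^bsub>alg\<^esub> x) g * \<epsilon> (g\<^sup>\<star> \<otimes> c))"
        proof (rule sum.mono_neutral_right)
          show "?H \<subseteq> ?R" using True by (auto simp: loops_def)
          show "\<forall>g\<in>?R - ?H. groupoid_map (y \<otimes>\<^bsub>alg\<^esub> x) g * \<epsilon> (g\<^sup>\<star> \<otimes> c) = 0"
          proof
            fix g assume g: "g \<in> ?R - ?H"
            then have gJ: "g \<in> J" and gc: "g \<otimes> g\<^sup>\<star> = c \<otimes> c\<^sup>\<star>" and gH: "g \<notin> ?H" by auto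
            note [simp] = S_carrier[OF J_S[OF gJ]]
            have "g\<^sup>\<star> \<otimes> c \<notin> ?H"
            proof
              assume *: "g\<^sup>\<star> \<otimes> c \<in> ?H"
              have "(g\<^sup>\<star> \<otimes> c) \<otimes> (g\<^sup>\<star> \<otimes> c)\<^sup>\<star> = g\<^sup>\<star> \<otimes> ((c \<otimes> c\<^sup>\<star>) \<otimes> g)" by (simp add: star_mult m_assoc)
              also have "\<dots> = g\<^sup>\<star> \<otimes> g" by (simp add: gc[symmetric] star_simps)
              finally have "g\<^sup>\<star> \<otimes> g = e" using HJ(3)[OF *] by simp
              then show False using gJ gc gH True by (simp add: loops_def)
            qed
            then show "groupoid_map (y \<otimes>\<^bsub>alg\<^esub> x) g * \<epsilon> (g\<^sup>\<star> \<otimes> c) = 0" by (simp add: eps_supp)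
          qed
        qed simp
        also have "\<dots> = (\<Sum>g\<in>?H. \<epsilon> g * \<epsilon> (g\<^sup>\<star> \<otimes> c))"
          by (rule sum.cong) (simp_all add: yyx)
        also have "\<dots> = \<epsilon> c"
        proof (cases "c \<in> ?H")
          case True
          then show ?thesis by (rule right_unit[OF eps, symmetric])
        next
          case False
          have "\<epsilon> (g\<^sup>\<star> \<otimes> c) = 0" if g: "g \<in> ?H" for g
          proof (rule eps_supp, rule notI)
            assume "g\<^sup>\<star> \<otimes> c \<in> ?H"
            then have "g \<otimes> (g\<^sup>\<star> \<otimes> c) \<in> ?H" by (rule multH[OF g])
            moreover have "g \<otimes> (g\<^sup>\<star> \<otimes> c) = (g \<otimes> g\<^sup>\<star>) \<otimes> c" using HJ(2)[OF g] by (simp add: m_assoc)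
            moreover have "(g \<otimes> g\<^sup>\<star>) \<otimes> c = c"
              using HJ(3)[OF g] \<open>c \<otimes> c\<^sup>\<star> = e\<close>[symmetric] by (simp add: star_simps)
            ultimately show False using False by simp
          qed
          then show ?thesis using eps_supp[OF False] by simp
        qed
        finally show ?thesis .
      qed
      finally show ?thesis .
    qed
    let ?w = "(\<one>\<^bsub>alg\<^esub> \<ominus>\<^bsub>alg\<^esub> (y \<otimes>\<^bsub>alg\<^esub> x)) \<otimes>\<^bsub>alg\<^esub> y"
    have yxyc: "(y \<otimes>\<^bsub>alg\<^esub> x) \<otimes>\<^bsub>alg\<^esub> y \<in> carrier alg" by (rule A.m_closed[OF yxc yc])
    have wc: "?w \<in> carrier alg" by (intro A.m_closed A.minus_closed A.one_closed yxc yc)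
    have "?w \<oplus>\<^bsub>alg\<^esub> (y \<otimes>\<^bsub>alg\<^esub> x) \<otimes>\<^bsub>alg\<^esub> y = y"
      using yxc yc by (simp only: A.l_distr[symmetric] A.one_closed a_minus_def A.a_closed
          A.a_assoc A.a_inv_closed A.l_neg A.r_zero A.l_one)
    then have wy: "(\<lambda>s. ?w s + ((y \<otimes>\<^bsub>alg\<^esub> x) \<otimes>\<^bsub>alg\<^esub> y) s) = y" by simp
    have w0: "groupoid_map ?w c = 0" if c: "c \<in> J" for c
      using groupoid_map_add[of ?w "(y \<otimes>\<^bsub>alg\<^esub> x) \<otimes>\<^bsub>alg\<^esub> y" c] yxy[OF c] y(2)[OF c]
      unfolding wy by simp
    have "z \<otimes>\<^bsub>alg\<^esub> ?w = y"
      using z(1) A.m_assoc[OF z(1) A.minus_closed[OF A.one_closed yxc] yc] A.l_one[OF yc]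
      unfolding z(2) by simp
    moreover have "groupoid_map (z \<otimes>\<^bsub>alg\<^esub> ?w) c = 0" if c: "c \<in> J" for c
      unfolding groupoid_map_mult[OF c]
    proof (rule sum.neutral, rule ballI)
      fix g assume "g \<in> {g \<in> J. g \<otimes> g\<^sup>\<star> = c \<otimes> c\<^sup>\<star>}"
      then have "groupoid_map ?w (g\<^sup>\<star> \<otimes> c) = 0" using c by (intro w0 J_mult) auto
      then show "groupoid_map z g * groupoid_map ?w (g\<^sup>\<star> \<otimes> c) = 0" by (simp only: mult_zero_right)
    qed
    ultimately have eps0: "\<epsilon> c = 0" if "c \<in> J" for c
      using that y(2)[OF that] by simp
    have I0: "f e = 0" if f: "f \<in> I" for f
      unfolding right_unit[OF f eH] using eps0 multH[OF starH eH] HJ(1) by (intro sum.neutral) simp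
    \<comment> \<open>Composing with the arrow \<open>b\<^sup>\<star>\<close> moves the coefficient at \<open>b\<close> to the vertex \<open>e\<close>.\<close>
    let ?F = "\<lambda>h. if h = b\<^sup>\<star> then 1 else 0 :: 'k"
    obtain v :: "'a \<Rightarrow> 'k" where v: "v \<in> carrier subalg" "\<And>c. c \<in> J \<Longrightarrow> groupoid_map v c = ?F c"
      using groupoid_map_surj[of ?F] by blast
    have va: "v \<otimes>\<^bsub>alg\<^esub> a \<in> ?Rad" by (rule rad(4)[OF S_algI[OF v(1)] a])
    have "groupoid_map (v \<otimes>\<^bsub>alg\<^esub> a) e
        = (\<Sum>g | g \<in> J \<and> g \<otimes> g\<^sup>\<star> = e \<otimes> e\<^sup>\<star>. if g = b\<^sup>\<star> then groupoid_map a (b \<otimes> e) else 0)"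
      unfolding groupoid_map_mult[OF eJ] by (rule sum.cong) (auto simp: v(2))
    also have "\<dots> = groupoid_map a (b \<otimes> e)"
      using b by (simp add: sum.delta ee(1)) (simp add: e_def)
    also have "b \<otimes> e = b" by (simp add: e_def regular)
    finally have "groupoid_map (v \<otimes>\<^bsub>alg\<^esub> a) e = groupoid_map a b" .
    moreover have "groupoid_map (v \<otimes>\<^bsub>alg\<^esub> a) e = 0"
      using I0[of "\<lambda>h. if h \<in> ?H then groupoid_map (v \<otimes>\<^bsub>alg\<^esub> a) h else 0"] va eH
      by (auto simp: I_def)
    ultimately show False using nz by simp
  qed
  then show "a \<in> groupoid_kernel"
    using a rad(1) by (auto simp: groupoid_kernel_def)
qed

section \<open>The quotient algebra\<close>

lemma subalg_mult:
  assumes "a \<in> carrier subalg" "a' \<in> carrier subalg"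
  shows "a \<otimes>\<^bsub>subalg\<^esub> a' = a \<otimes>\<^bsub>alg\<^esub> a'"
proof
  fix s
  have "(\<Sum>p\<in>factorisations (T\<lparr>carrier := J\<rparr>) s. a (fst p) * a' (snd p))
      = (\<Sum>p\<in>factorisations (T\<lparr>carrier := S\<rparr>) s. a (fst p) * a' (snd p))"
    by (rule sum.mono_neutral_left)
      (use assms in \<open>auto simp: finite_factorisations\<close>, auto simp: factorisations_def)
  then show "(a \<otimes>\<^bsub>subalg\<^esub> a') s = (a \<otimes>\<^bsub>alg\<^esub> a') s" by (simp add: semigroup_algebra_mult)
qed

lemma alg_minus:
  assumes "a \<in> carrier alg" "a' \<in> carrier alg"
  shows "a \<ominus>\<^bsub>alg\<^esub> a' = (\<lambda>s. a s - a' s)"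
proof -
  interpret A: ring "alg :: ('k::field, 'a \<Rightarrow> 'k) module" by (rule alg_ring)
  have "\<ominus>\<^bsub>alg\<^esub> a' = (\<lambda>s. - a' s)"
    using assms by (intro A.minus_equality) auto
  then show ?thesis by (simp add: a_minus_def)
qed

lemma kernel_coset_eq_iff:
  assumes "a \<in> carrier alg" "a' \<in> carrier alg"
  shows "groupoid_kernel +>\<^bsub>alg\<^esub> a = groupoid_kernel +>\<^bsub>alg\<^esub> a' \<longleftrightarrow> (\<forall>b\<in>J. groupoid_map a b = groupoid_map a' b)"
proof -
  interpret A: ring "alg :: ('k::field, 'a \<Rightarrow> 'k) module" by (rule alg_ring)
  have "groupoid_kernel +>\<^bsub>alg\<^esub> a = groupoid_kernel +>\<^bsub>alg\<^esub> a' \<longleftrightarrow> a \<ominus>\<^bsub>alg\<^esub> a' \<in> groupoid_kernel"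
    by (rule A.quotient_eq_iff_same_a_r_cos[OF kernel_ideal assms, symmetric])
  then show ?thesis
    using assms by (auto simp: alg_minus groupoid_kernel_def groupoid_map_diff)
qed

text \<open>As the groupoid map is bijective on the subalgebra spanned by \<open>J\<close>, every coset of its kernel
  meets that subalgebra in exactly one element.\<close>

lemma quotient_kernel_iso: "quotient_algebra (alg :: ('k::field, 'a \<Rightarrow> 'k) module) groupoid_kernel \<simeq>\<^sub>a\<^sub>l\<^sub>g subalg"
proof -
  let ?A = "alg :: ('k, 'a \<Rightarrow> 'k) module"
  let ?B = "subalg :: ('k, 'a \<Rightarrow> 'k) module"
  let ?Q = "quotient_algebra ?A groupoid_kernel"
  interpret A: ring ?A by (rule alg_ring)
  interpret B: ring ?B by (rule subalg_ring)
  interpret N: ideal "groupoid_kernel :: ('a \<Rightarrow> 'k) set" ?A by (rule kernel_ideal)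
  note q = quotient_algebra_def ring.defs module.defs FactRing_def
  let ?g = "\<lambda>b. groupoid_kernel +>\<^bsub>?A\<^esub> b"
  have bij: "bij_betw ?g (carrier ?B) (carrier ?Q)"
  proof (rule bij_betw_imageI)
    show "inj_on ?g (carrier ?B)"
    proof (rule inj_onI)
      fix a a' assume a: "a \<in> carrier ?B" "a' \<in> carrier ?B" and eq: "?g a = ?g a'"
      have "(\<lambda>s. a s - a' s) = (\<lambda>_. 0)"
      proof (rule groupoid_map_inj)
        show "(\<lambda>s. a s - a' s) \<in> carrier ?B" using a by auto
        show "groupoid_map (\<lambda>s. a s - a' s) b = 0" if "b \<in> J" for b
          using that eq kernel_coset_eq_iff[OF S_algI[OF a(1)] S_algI[OF a(2)]]
          by (simp add: groupoid_map_diff)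
      qed
      then show "a = a'" by (simp add: fun_eq_iff)
    qed
    show "?g ` carrier ?B = carrier ?Q"
    proof
      show "?g ` carrier ?B \<subseteq> carrier ?Q"
      proof (rule image_subsetI)
        fix b assume "b \<in> carrier ?B"
        then have "b \<in> carrier ?A" by (rule S_algI)
        then show "?g b \<in> carrier ?Q" by (simp only: q A.a_rcosetsI[OF N.a_subset] ring.simps partial_object.simps)
      qed
      show "carrier ?Q \<subseteq> ?g ` carrier ?B"
      proof
        fix C assume "C \<in> carrier ?Q"
        then obtain a where a: "a \<in> carrier ?A" "C = ?g a"
          by (auto simp: q A_RCOSETS_def')
        obtain b where b: "b \<in> carrier ?B" "\<And>c. c \<in> J \<Longrightarrow> groupoid_map b c = groupoid_map a c"
          using groupoid_map_surj[of "groupoid_map a"] by blast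
        then have "C = ?g b"
          using a kernel_coset_eq_iff[OF a(1) S_algI[OF b(1)]] by simp
        then show "C \<in> ?g ` carrier ?B" using b(1) by blast
      qed
    qed
  qed
  have iso: "?g \<in> ring_iso ?B ?Q"
  proof (rule ring_iso_memI)
    fix a a' assume a: "a \<in> carrier ?B" "a' \<in> carrier ?B"
    note c = S_algI[OF a(1)] S_algI[OF a(2)]
    show "?g (a \<otimes>\<^bsub>?B\<^esub> a') = ?g a \<otimes>\<^bsub>?Q\<^esub> ?g a'"
      unfolding subalg_mult[OF a] using N.rcoset_mult_add[OF c] by (simp add: q)
    have "?g (a \<oplus>\<^bsub>?A\<^esub> a') = ?g a \<oplus>\<^bsub>?Q\<^esub> ?g a'"
      using N.a_rcos_sum[OF c] by (simp add: q)
    then show "?g (a \<oplus>\<^bsub>?B\<^esub> a') = ?g a \<oplus>\<^bsub>?Q\<^esub> ?g a'" by simp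
  next
    show "?g \<one>\<^bsub>?B\<^esub> = \<one>\<^bsub>?Q\<^esub>" by (simp add: q)
  next
    show "?g b \<in> carrier ?Q" if "b \<in> carrier ?B" for b
      using bij that by (rule bij_betwE[THEN bspec])
  qed (rule bij)
  have smult: "?g (c \<odot>\<^bsub>?B\<^esub> b) = c \<odot>\<^bsub>?Q\<^esub> ?g b" if b: "b \<in> carrier ?B" for c b
  proof -
    have bA: "b \<in> carrier ?A" by (rule S_algI[OF b])
    have "?g (c \<odot>\<^bsub>?A\<^esub> x) = ?g (c \<odot>\<^bsub>?A\<^esub> b)" if x: "x \<in> ?g b" for x
    proof -
      have xA: "x \<in> carrier ?A" by (rule N.a_elemrcos_carrier[OF bA x])
      have "?g b = ?g x" using N.a_repr_independence'[OF x bA] .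
      then have "\<forall>d\<in>J. groupoid_map b d = groupoid_map x d"
        using kernel_coset_eq_iff[OF bA xA] by simp
      then show ?thesis
        using xA bA by (subst kernel_coset_eq_iff) (auto simp: groupoid_map_scale)
    qed
    moreover have "b \<in> ?g b" by (rule N.a_rcos_self[OF bA])
    ultimately have "(\<Union>x\<in>?g b. ?g (c \<odot>\<^bsub>?A\<^esub> x)) = ?g (c \<odot>\<^bsub>?A\<^esub> b)" by blast
    then show ?thesis by (simp add: q)
  qed
  let ?f = "inv_into (carrier ?B) ?g"
  have "?f (c \<odot>\<^bsub>?Q\<^esub> C) = c \<odot>\<^bsub>?B\<^esub> ?f C" if C: "C \<in> carrier ?Q" for c C
  proof -
    have Cim: "C \<in> ?g ` carrier ?B" using bij C by (simp only: bij_betw_def)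
    note fC = inv_into_into[OF Cim] f_inv_into_f[OF Cim]
    have "c \<odot>\<^bsub>?B\<^esub> ?f C \<in> carrier ?B" using fC(1) by auto
    moreover have "c \<odot>\<^bsub>?Q\<^esub> C = ?g (c \<odot>\<^bsub>?B\<^esub> ?f C)" using smult[OF fC(1)] fC(2) by simp
    ultimately show ?thesis
      using bij_betw_inv_into_left[OF bij] by simp
  qed
  moreover have "?f \<in> ring_iso ?Q ?B"
    by (rule ring_iso_set_sym[OF subalg_ring iso])
  ultimately show ?thesis
    unfolding algebra_isomorphic_def algebra_iso_def by blast
qed

theorem semisimple_quotient_iso:
  assumes "\<And>b. b \<in> J \<Longrightarrow> of_nat (card (loops (b\<^sup>\<star> \<otimes> b))) \<noteq> (0 :: 'k::field)"
  shows "quotient_algebra (alg :: ('k, 'a \<Rightarrow> 'k) module) (jacobson_radical alg) \<simeq>\<^sub>a\<^sub>l\<^sub>g subalg"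
proof -
  have "jacobson_radical (alg :: ('k, 'a \<Rightarrow> 'k) module) = groupoid_kernel"
    using radical_le_kernel[OF assms] kernel_le_radical by (rule equalityI)
  then show ?thesis using quotient_kernel_iso by simp
qed

end

section \<open>The partition monoid\<close>

definition same_block :: "'b set set \<Rightarrow> 'b rel" where
  "same_block P = {(u, v). \<exists>B\<in>P. u \<in> B \<and> v \<in> B}"

lemma same_block_equiv: "partition_on V P \<Longrightarrow> equiv V (same_block P)"
  unfolding same_block_def by (rule equiv_partition_on)

lemma same_blockD:
  assumes "partition_on V P" "(u, v) \<in> same_block P"
  shows "u \<in> V" "v \<in> V" "(v, u) \<in> same_block P"
  using assms by (auto simp: same_block_def partition_on_def)

lemma same_block_refl: "partition_on V P \<Longrightarrow> u \<in> V \<Longrightarrow> (u, u) \<in> same_block P"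
  by (auto simp: same_block_def partition_on_def)

lemma same_block_trans:
  "partition_on V P \<Longrightarrow> (u, v) \<in> same_block P \<Longrightarrow> (v, w) \<in> same_block P \<Longrightarrow> (u, w) \<in> same_block P"
  using same_block_equiv[of V P] by (auto simp: equiv_def dest: transD)

lemma same_block_inject:
  assumes "partition_on V P" "partition_on V P'" "same_block P = same_block P'"
  shows "P = P'"
proof -
  have "P = V // same_block P"
    unfolding same_block_def by (rule partition_on_eq_quotient[OF assms(1), symmetric])
  also have "\<dots> = V // same_block P'" by (simp only: assms(3))
  also have "\<dots> = P'"
    unfolding same_block_def by (rule partition_on_eq_quotient[OF assms(2)])
  finally show ?thesis .
qed

lemma same_block_quotient:
  assumes "equiv V R"
  shows "same_block (V // R) = R"
proof -
  have sub: "R \<subseteq> V \<times> V" using assms by (auto simp: equiv_def refl_on_def)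
  have "(u, v) \<in> same_block (V // R) \<longleftrightarrow> (u, v) \<in> R" for u v
  proof
    assume "(u, v) \<in> same_block (V // R)"
    then obtain w where "(w, u) \<in> R" "(w, v) \<in> R" by (auto simp: same_block_def quotient_def)
    then show "(u, v) \<in> R" using assms by (meson equivE symD transD)
  next
    assume uv: "(u, v) \<in> R"
    then have "u \<in> V" "(u, u) \<in> R" using sub assms by (auto simp: equiv_def refl_on_def)
    then show "(u, v) \<in> same_block (V // R)"
      using uv by (auto simp: same_block_def intro!: bexI[OF _ quotientI])
  qed
  then show ?thesis by auto
qed

text \<open>The vertex \<open>(i, x)\<close> is the copy of \<open>x\<close> in layer \<open>i\<close>. Numbering the layers, unlike naming three of
  them, leaves room for products of three factors, drawn on four layers.\<close>

definition place :: "nat \<Rightarrow> nat \<Rightarrow> 'a + 'a \<Rightarrow> nat \<times> 'a" where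
  "place i j = case_sum (Pair i) (Pair j)"

lemma place_simps [simp]: "place i j (Inl x) = (i, x)" "place i j (Inr x) = (j, x)"
  by (simp_all add: place_def)

definition edges :: "nat \<Rightarrow> nat \<Rightarrow> 'a part \<Rightarrow> (nat \<times> 'a) rel" where
  "edges i j \<alpha> = map_prod (place i j) (place i j) ` same_block \<alpha>"

lemma edgesI: "(u, v) \<in> same_block \<alpha> \<Longrightarrow> (place i j u, place i j v) \<in> edges i j \<alpha>"
  unfolding edges_def by (rule image_eqI[of _ _ "(u, v)"]) simp_all

lemma edgesE:
  assumes "(p, q) \<in> edges i j \<alpha>"
  obtains u v where "(u, v) \<in> same_block \<alpha>" "p = place i j u" "q = place i j v"
proof -
  obtain e where "(p, q) = map_prod (place i j) (place i j) e" "e \<in> same_block \<alpha>"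
    using assms unfolding edges_def by (rule imageE)
  then show ?thesis using that[of "fst e" "snd e"] by (cases e) simp
qed

lemma rtrancl_hom:
  assumes "(x, y) \<in> R\<^sup>*" and "\<And>a b. (a, b) \<in> R \<Longrightarrow> (f a, f b) \<in> S\<^sup>*"
  shows "(f x, f y) \<in> S\<^sup>*"
  using assms(1)
proof induction
  case (step y z)
  show ?case by (rule rtrancl_trans[OF step.IH assms(2)[OF step.hyps(2)]])
qed simp

lemma rtrancl_inj_image:
  assumes f: "inj f"
  shows "(f x, f y) \<in> (map_prod f f ` R)\<^sup>* \<longleftrightarrow> (x, y) \<in> R\<^sup>*"
proof
  assume "(x, y) \<in> R\<^sup>*"
  then show "(f x, f y) \<in> (map_prod f f ` R)\<^sup>*"
  proof (rule rtrancl_hom)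
    show "(f a, f b) \<in> (map_prod f f ` R)\<^sup>*" if "(a, b) \<in> R" for a b
      by (rule r_into_rtrancl, rule rev_image_eqI[OF that]) simp
  qed
next
  have preimage: "\<exists>y. q = f y \<and> (x, y) \<in> R\<^sup>*" if "(f x, q) \<in> (map_prod f f ` R)\<^sup>*" for q
    using that
  proof induction
    case base
    show ?case by blast
  next
    case (step q q')
    from step.IH obtain y where y: "q = f y" "(x, y) \<in> R\<^sup>*" by blast
    obtain e where e: "(q, q') = map_prod f f e" "e \<in> R" using step.hyps(2) by (rule imageE)
    have "fst e = y" using e(1) y(1) f by (cases e) (simp add: inj_eq)
    then have "(x, snd e) \<in> R\<^sup>*"
      using y(2) e(2) by (cases e) (simp add: rtrancl.rtrancl_into_rtrancl)
    moreover have "q' = f (snd e)" using e(1) by (cases e) simp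
    ultimately show ?case by blast
  qed
  assume "(f x, f y) \<in> (map_prod f f ` R)\<^sup>*"
  then show "(x, y) \<in> R\<^sup>*" using preimage[of "f y"] f by (simp add: inj_eq)
qed

text \<open>A walk in \<open>P \<union> Q\<close> between points of \<open>D\<close> is cut at its \<open>Q\<close>-steps; the stretches of \<open>P\<close>-steps in between
  start and end in \<open>D\<close>.\<close>

lemma rtrancl_glue:
  assumes Q: "Q \<subseteq> D \<times> D" and u: "u \<in> D" and v: "v \<in> D"
  shows "(u, v) \<in> (P \<union> Q)\<^sup>* \<longleftrightarrow> (u, v) \<in> (P\<^sup>* \<inter> D \<times> D \<union> Q)\<^sup>*"
proof
  let ?R = "P\<^sup>* \<inter> D \<times> D \<union> Q"
  assume "(u, v) \<in> (P \<union> Q)\<^sup>*"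
  then have "\<exists>w\<in>D. (u, w) \<in> ?R\<^sup>* \<and> (w, v) \<in> P\<^sup>*"
  proof induction
    case base
    then show ?case using u by auto
  next
    case (step y z)
    then obtain w where w: "w \<in> D" "(u, w) \<in> ?R\<^sup>*" "(w, y) \<in> P\<^sup>*" by auto
    show ?case
    proof (cases "(y, z) \<in> P")
      case True
      then show ?thesis using w by (auto intro: rtrancl.rtrancl_into_rtrancl)
    next
      case False
      then have yz: "(y, z) \<in> Q" using step.hyps by auto
      then have "y \<in> D" "z \<in> D" using Q by auto
      then have "(w, y) \<in> ?R" using w by auto
      then have "(u, z) \<in> ?R\<^sup>*" using w(2) yz by (meson UnI2 rtrancl.rtrancl_into_rtrancl)
      then show ?thesis using \<open>z \<in> D\<close> by auto
    qed
  qed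
  then obtain w where w: "w \<in> D" "(u, w) \<in> ?R\<^sup>*" "(w, v) \<in> P\<^sup>*" by auto
  then have "(w, v) \<in> ?R" using v by auto
  then show "(u, v) \<in> ?R\<^sup>*" using w(2) by (rule rtrancl.rtrancl_into_rtrancl[rotated])
next
  have "P\<^sup>* \<inter> D \<times> D \<union> Q \<subseteq> (P \<union> Q)\<^sup>*"
    using rtrancl_mono[of P "P \<union> Q"] by auto
  then show "(u, v) \<in> (P\<^sup>* \<inter> D \<times> D \<union> Q)\<^sup>* \<Longrightarrow> (u, v) \<in> (P \<union> Q)\<^sup>*"
    using subsetD[OF rtrancl_subset_rtrancl] by blast
qed

lemma product_graph_eq:
  "product_graph \<alpha> \<beta> = map_prod (case_sum Upper Middle) (case_sum Upper Middle) ` same_block \<alpha>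
    \<union> map_prod (case_sum Middle Lower) (case_sum Middle Lower) ` same_block \<beta>"
proof -
  have "map_prod f f ` same_block P = {(f u, f v) | u v. \<exists>B\<in>P. u \<in> B \<and> v \<in> B}"
    for f :: "'a + 'a \<Rightarrow> 'a layer" and P
    unfolding same_block_def by (auto simp: image_iff)
  then show ?thesis by (simp only: product_graph_def)
qed

lemma vertices_simps [simp]: "Inl x \<in> vertices X \<longleftrightarrow> x \<in> X" "Inr x \<in> vertices X \<longleftrightarrow> x \<in> X"
  by (auto simp: vertices_def)

lemma product_graph_layers:
  fixes \<alpha> \<beta> :: "'a part"
  assumes "distinct [i, j, k]"
  shows "(case_sum Upper Lower u, case_sum Upper Lower v) \<in> (product_graph \<alpha> \<beta>)\<^sup>* \<longleftrightarrow>
    (place i k u, place i k v) \<in> (edges i j \<alpha> \<union> edges j k \<beta>)\<^sup>*"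
proof -
  define f where "f = (\<lambda>l :: 'a layer. case l of Upper x \<Rightarrow> (i, x) | Middle x \<Rightarrow> (j, x) | Lower x \<Rightarrow> (k, x))"
  have inj: "inj f" using assms by (auto simp: f_def inj_def split: layer.splits)
  have f1: "f \<circ> case_sum Upper Middle = place i j" and f2: "f \<circ> case_sum Middle Lower = place j k"
    and f3: "f \<circ> case_sum Upper Lower = place i k"
    by (auto simp: f_def place_def fun_eq_iff split: sum.splits)
  have "map_prod f f ` product_graph \<alpha> \<beta> = edges i j \<alpha> \<union> edges j k \<beta>"
    unfolding product_graph_eq edges_def f1[symmetric] f2[symmetric]
    by (simp add: image_Un image_image map_prod_def case_prod_beta)
  then show ?thesis
    using rtrancl_inj_image[OF inj, of "case_sum Upper Lower u" "case_sum Upper Lower v" "product_graph \<alpha> \<beta>"]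
    by (simp add: f3[symmetric])
qed

lemma product_graph_sym: "sym (product_graph \<alpha> \<beta>)"
  unfolding product_graph_def by (rule symI) blast

lemma part_mult_equiv:
  assumes "partition_on (vertices X) \<alpha>" "partition_on (vertices X) \<beta>"
  shows "equiv (vertices X) {(u, v) \<in> vertices X \<times> vertices X.
    (case_sum Upper Lower u, case_sum Upper Lower v) \<in> (product_graph \<alpha> \<beta>)\<^sup>*}"
  using sym_rtrancl[OF product_graph_sym[of \<alpha> \<beta>]]
  by (intro equivI refl_onI symI transI) (auto dest: symD intro: rtrancl_trans)

lemma part_mult_part:
  assumes "partition_on (vertices X) \<alpha>" "partition_on (vertices X) \<beta>"
  shows "partition_on (vertices X) (part_mult X \<alpha> \<beta>)"
  unfolding part_mult_def by (rule partition_on_quotient[OF part_mult_equiv[OF assms]])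

lemma same_block_mult:
  assumes "partition_on (vertices X) \<alpha>" "partition_on (vertices X) \<beta>" and ijk: "distinct [i, j, k]"
  shows "(u, v) \<in> same_block (part_mult X \<alpha> \<beta>) \<longleftrightarrow> u \<in> vertices X \<and> v \<in> vertices X \<and>
    (place i k u, place i k v) \<in> (edges i j \<alpha> \<union> edges j k \<beta>)\<^sup>*"
  unfolding part_mult_def same_block_quotient[OF part_mult_equiv[OF assms(1,2)]]
  by (simp add: product_graph_layers[OF ijk])

lemma edges_layers:
  assumes "partition_on (vertices X) \<alpha>" "(p, q) \<in> edges i j \<alpha>"
  shows "p \<in> {i, j} \<times> X" "q \<in> {i, j} \<times> X"
proof -
  obtain u v where uv: "(u, v) \<in> same_block \<alpha>" "p = place i j u" "q = place i j v"
    using assms(2) by (rule edgesE)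
  have "u \<in> vertices X" "v \<in> vertices X" using same_blockD(1,2)[OF assms(1) uv(1)] .
  then show "p \<in> {i, j} \<times> X" "q \<in> {i, j} \<times> X"
    unfolding uv(2,3) by (auto simp: vertices_def)
qed

lemma place_vertex:
  assumes "p \<in> {i, k} \<times> X"
  shows "\<exists>w\<in>vertices X. p = place i k w"
proof (cases "fst p = i")
  case True
  then show ?thesis using assms by (intro bexI[of _ "Inl (snd p)"]) auto
next
  case False
  then show ?thesis using assms by (intro bexI[of _ "Inr (snd p)"]) auto
qed

text \<open>Two stacked partitions inside a larger graph may be replaced by their product, provided that the
  rest \<open>Q\<close> of the graph avoids the middle layer \<open>j\<close>. Associativity follows by gluing in two ways.\<close>

lemma glue_product:
  assumes a: "partition_on (vertices X) \<alpha>" and b: "partition_on (vertices X) \<beta>" and ijk: "distinct [i, j, k]"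
    and Q: "Q \<subseteq> D \<times> D" and D: "{i, k} \<times> X \<subseteq> D" "\<And>x. (j, x) \<notin> D"
    and u: "u \<in> D" and v: "v \<in> D"
  shows "(u, v) \<in> (edges i j \<alpha> \<union> edges j k \<beta> \<union> Q)\<^sup>* \<longleftrightarrow>
    (u, v) \<in> (edges i k (part_mult X \<alpha> \<beta>) \<union> Q)\<^sup>*"
proof -
  let ?P = "edges i j \<alpha> \<union> edges j k \<beta>"
  let ?E = "edges i k (part_mult X \<alpha> \<beta>)"
  have field: "p \<in> {i, j, k} \<times> X" "q \<in> {i, j, k} \<times> X" if "(p, q) \<in> ?P" for p q
    using that edges_layers[OF a, of p q i j] edges_layers[OF b, of p q j k] by auto
  have "?E \<subseteq> ?P\<^sup>* \<inter> D \<times> D"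
  proof (rule subrelI)
    fix p q assume pq: "(p, q) \<in> ?E"
    then obtain w z where "(w, z) \<in> same_block (part_mult X \<alpha> \<beta>)" "p = place i k w" "q = place i k z"
      by (rule edgesE)
    then have "(p, q) \<in> ?P\<^sup>*" by (simp add: same_block_mult[OF a b ijk])
    moreover have "p \<in> D" "q \<in> D"
      using edges_layers[OF part_mult_part[OF a b] pq] D(1) by auto
    ultimately show "(p, q) \<in> ?P\<^sup>* \<inter> D \<times> D" by auto
  qed
  moreover have "?P\<^sup>* \<inter> D \<times> D \<subseteq> ?E\<^sup>="
  proof (rule subrelI)
    fix p q assume pq: "(p, q) \<in> ?P\<^sup>* \<inter> D \<times> D"
    show "(p, q) \<in> ?E\<^sup>="
    proof (cases "p = q")
      case False
      have star: "(p, q) \<in> ?P\<^sup>*" using pq by auto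
      obtain r where "(p, r) \<in> ?P" using star False by (meson converse_rtranclE)
      moreover obtain s where "(s, q) \<in> ?P" using star False by (meson rtranclE)
      ultimately have "p \<in> {i, k} \<times> X" "q \<in> {i, k} \<times> X"
        using field[of p r] field[of s q] D(2) pq by auto
      then obtain w z where wz: "w \<in> vertices X" "p = place i k w" "z \<in> vertices X" "q = place i k z"
        using place_vertex by metis
      then have "(w, z) \<in> same_block (part_mult X \<alpha> \<beta>)"
        using star by (simp add: same_block_mult[OF a b ijk])
      then show ?thesis using wz by (auto intro: edgesI)
    qed auto
  qed
  ultimately have "(?P\<^sup>* \<inter> D \<times> D \<union> Q)\<^sup>* = (?E \<union> Q)\<^sup>*"
    by (intro rtrancl_subset) auto
  then show ?thesis using rtrancl_glue[OF Q u v, of ?P] by (simp only:)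
qed

lemma part_mult_triple_left:
  assumes a: "partition_on (vertices X) \<alpha>" and b: "partition_on (vertices X) \<beta>"
    and c: "partition_on (vertices X) \<gamma>"
  shows "(u, v) \<in> same_block (part_mult X (part_mult X \<alpha> \<beta>) \<gamma>) \<longleftrightarrow>
    u \<in> vertices X \<and> v \<in> vertices X \<and>
    (place 0 3 u, place 0 3 v) \<in> (edges 0 1 \<alpha> \<union> edges 1 2 \<beta> \<union> edges 2 3 \<gamma>)\<^sup>*"
proof -
  have "(place 0 3 u, place 0 3 v) \<in> (edges 0 1 \<alpha> \<union> edges 1 2 \<beta> \<union> edges 2 3 \<gamma>)\<^sup>* \<longleftrightarrow>
      (place 0 3 u, place 0 3 v) \<in> (edges 0 2 (part_mult X \<alpha> \<beta>) \<union> edges 2 3 \<gamma>)\<^sup>*"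
    if "u \<in> vertices X" "v \<in> vertices X"
  proof (rule glue_product[OF a b, where D = "{0, 2, 3} \<times> X"])
    show "edges 2 3 \<gamma> \<subseteq> ({0, 2, 3} \<times> X) \<times> ({0, 2, 3} \<times> X)"
      using edges_layers[OF c, of _ _ 2 3] by fastforce
  qed (use that in \<open>auto simp: vertices_def\<close>)
  then show ?thesis
    using same_block_mult[OF part_mult_part[OF a b] c, of 0 2 3 u v] by auto
qed

lemma part_mult_triple_right:
  assumes a: "partition_on (vertices X) \<alpha>" and b: "partition_on (vertices X) \<beta>"
    and c: "partition_on (vertices X) \<gamma>"
  shows "(u, v) \<in> same_block (part_mult X \<alpha> (part_mult X \<beta> \<gamma>)) \<longleftrightarrow>
    u \<in> vertices X \<and> v \<in> vertices X \<and>
    (place 0 3 u, place 0 3 v) \<in> (edges 0 1 \<alpha> \<union> edges 1 2 \<beta> \<union> edges 2 3 \<gamma>)\<^sup>*"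
proof -
  have "(place 0 3 u, place 0 3 v) \<in> (edges 1 2 \<beta> \<union> edges 2 3 \<gamma> \<union> edges 0 1 \<alpha>)\<^sup>* \<longleftrightarrow>
      (place 0 3 u, place 0 3 v) \<in> (edges 1 3 (part_mult X \<beta> \<gamma>) \<union> edges 0 1 \<alpha>)\<^sup>*"
    if "u \<in> vertices X" "v \<in> vertices X"
  proof (rule glue_product[OF b c, where D = "{0, 1, 3} \<times> X"])
    show "edges 0 1 \<alpha> \<subseteq> ({0, 1, 3} \<times> X) \<times> ({0, 1, 3} \<times> X)"
      using edges_layers[OF a, of _ _ 0 1] by fastforce
  qed (use that in \<open>auto simp: vertices_def\<close>)
  then show ?thesis
    using same_block_mult[OF a part_mult_part[OF b c], of 0 1 3 u v] by (auto simp: Un_ac)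
qed

lemma part_mult_assoc:
  assumes "partition_on (vertices X) \<alpha>" "partition_on (vertices X) \<beta>" "partition_on (vertices X) \<gamma>"
  shows "part_mult X (part_mult X \<alpha> \<beta>) \<gamma> = part_mult X \<alpha> (part_mult X \<beta> \<gamma>)"
proof (rule same_block_inject[of "vertices X"])
  show "same_block (part_mult X (part_mult X \<alpha> \<beta>) \<gamma>) = same_block (part_mult X \<alpha> (part_mult X \<beta> \<gamma>))"
    by (rule Set.set_eqI, clarify) (simp only: part_mult_triple_left[OF assms] part_mult_triple_right[OF assms])
qed (intro part_mult_part assms)+

definition flip :: "'a + 'a \<Rightarrow> 'a + 'a" where
  "flip = case_sum Inr Inl"

lemma flip_simps [simp]: "flip (Inl x) = Inr x" "flip (Inr x) = Inl x"
  by (simp_all add: flip_def)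

lemma flip_flip [simp]: "flip (flip u) = u"
  by (cases u) simp_all

lemma flip_vertices [simp]: "flip u \<in> vertices X \<longleftrightarrow> u \<in> vertices X"
  by (cases u) simp_all

lemma place_flip [simp]: "place i j (flip u) = place j i u"
  by (cases u) simp_all

definition part_star :: "'a part \<Rightarrow> 'a part" where
  "part_star \<alpha> = (`) flip ` \<alpha>"

lemma part_star_star [simp]: "part_star (part_star \<alpha>) = \<alpha>"
  by (simp add: part_star_def image_image)

lemma same_block_star: "(u, v) \<in> same_block (part_star \<alpha>) \<longleftrightarrow> (flip u, flip v) \<in> same_block \<alpha>"
proof -
  have "u \<in> flip ` B \<longleftrightarrow> flip u \<in> B" for u :: "'a + 'a" and B
    by (metis flip_flip image_iff)
  then show ?thesis by (simp add: same_block_def part_star_def)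
qed

lemma part_star_part:
  assumes "partition_on (vertices X) \<alpha>"
  shows "partition_on (vertices X) (part_star \<alpha>)"
proof -
  have "inj_on flip (vertices X)" by (rule inj_on_inverseI) (rule flip_flip)
  then have "partition_on (flip ` vertices X) (part_star \<alpha>)"
    using partition_on_inj_image[OF assms \<open>inj_on flip (vertices X)\<close>] partition_onD3[OF assms]
    by (simp add: part_star_def image_iff Diff_insert0)
  moreover have "flip ` vertices X = vertices X"
    by (auto simp: vertices_def image_Un image_image)
  ultimately show ?thesis by simp
qed

lemma edges_star: "edges i j (part_star \<alpha>) = edges j i \<alpha>"
proof -
  have sub: "edges j i \<alpha> \<subseteq> edges i j (part_star \<alpha>)" for i j :: nat and \<alpha> :: "'a part"
  proof (rule subrelI)
    fix p q assume "(p, q) \<in> edges j i \<alpha>"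
    then obtain u v where uv: "(u, v) \<in> same_block \<alpha>" "p = place j i u" "q = place j i v"
      by (rule edgesE)
    then have "(flip u, flip v) \<in> same_block (part_star \<alpha>)" by (simp add: same_block_star)
    from edgesI[OF this, of i j] show "(p, q) \<in> edges i j (part_star \<alpha>)" by (simp add: uv(2,3))
  qed
  show ?thesis using sub[of j i \<alpha>] sub[of i j "part_star \<alpha>"] by auto
qed

lemma part_star_mult:
  assumes a: "partition_on (vertices X) \<alpha>" and b: "partition_on (vertices X) \<beta>"
  shows "part_star (part_mult X \<alpha> \<beta>) = part_mult X (part_star \<beta>) (part_star \<alpha>)"
proof (rule same_block_inject[of "vertices X"])
  have "(u, v) \<in> same_block (part_star (part_mult X \<alpha> \<beta>)) \<longleftrightarrow>
      (u, v) \<in> same_block (part_mult X (part_star \<beta>) (part_star \<alpha>))" for u v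
    using same_block_mult[OF a b, of 0 1 2 "flip u" "flip v"]
      same_block_mult[OF part_star_part[OF b] part_star_part[OF a], of 2 1 0 u v]
    by (simp add: same_block_star edges_star Un_commute)
  then show "same_block (part_star (part_mult X \<alpha> \<beta>)) =
      same_block (part_mult X (part_star \<beta>) (part_star \<alpha>))"
    by (intro Set.set_eqI, clarify)
qed (intro part_star_part part_mult_part a b)+

text \<open>Bounds the connectivity of a layered graph: if folding its layers onto those of \<open>P\<close> maps every
  edge into a block, then so does it with every walk.\<close>

lemma rtrancl_fold:
  assumes P: "partition_on V P" and "(p, q) \<in> R\<^sup>*" and "f p \<in> V"
    and "\<And>a b. (a, b) \<in> R \<Longrightarrow> (f a, f b) \<in> same_block P"
  shows "(f p, f q) \<in> same_block P"
  using assms(2)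
proof induction
  case base
  show ?case by (rule same_block_refl[OF P assms(3)])
next
  case (step y z)
  show ?case by (rule same_block_trans[OF P step.IH assms(4)[OF step.hyps(2)]])
qed

text \<open>In the graph of \<open>\<alpha> \<alpha>\<^sup>\<star> \<alpha>\<close> on the layers 0 to 3 all edges are copies of edges of \<open>\<alpha>\<close>, with the even layers
  as upper and the odd layers as lower vertices. Folding along this parity is the identity on
  layers 0 and 3.\<close>

lemma part_regular:
  assumes a: "partition_on (vertices X) \<alpha>"
  shows "part_mult X \<alpha> (part_mult X (part_star \<alpha>) \<alpha>) = \<alpha>"
proof (rule same_block_inject[of "vertices X"])
  let ?E = "edges 0 1 \<alpha> \<union> edges 2 1 \<alpha> \<union> edges 2 3 \<alpha>"
  define f :: "nat \<times> 'a \<Rightarrow> 'a + 'a" where "f = (\<lambda>(i, x). if even i then Inl x else Inr x)"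
  have f: "f (place i j u) = u" if "even i" "odd j" for i j u
    using that by (cases u) (simp_all add: f_def)
  have fold: "(f p, f q) \<in> same_block \<alpha>" if "(p, q) \<in> ?E" for p q
    using that by (auto elim!: edgesE simp: f)
  have "(u, v) \<in> same_block \<alpha>"
    if uv: "u \<in> vertices X" "(place 0 3 u, place 0 3 v) \<in> ?E\<^sup>*" for u v
    using rtrancl_fold[OF a uv(2), of f] uv(1) fold by (simp add: f)
  moreover have "(place 0 3 u, place 0 3 v) \<in> ?E\<^sup>*" if uv: "(u, v) \<in> same_block \<alpha>" for u v
  proof -
    have e: "(place 0 1 u, place 0 1 v) \<in> ?E" "(place 2 1 v, place 2 1 v) \<in> ?E"
        "(place 2 3 u, place 2 3 v) \<in> ?E" "(place 2 1 u, place 2 1 v) \<in> ?E"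
      using uv same_block_refl[OF a same_blockD(2)[OF a uv]] by (simp_all add: edgesI)
    show ?thesis
    proof (cases u; cases v)
      fix x y assume "u = Inl x" "v = Inl y"
      then show ?thesis using e(1) by auto
    next
      fix x y assume "u = Inr x" "v = Inr y"
      then show ?thesis using e(3) by auto
    next
      fix x y assume *: "u = Inl x" "v = Inr y"
      have "(place 2 1 v, place 2 1 u) \<in> ?E"
        using same_blockD(3)[OF a uv] by (simp add: edgesI)
      then have "((0, x), (1, y)) \<in> ?E" "((1, y), (2, x)) \<in> ?E" "((2, x), (3, y)) \<in> ?E"
        using e * by auto
      then have "((0, x), (3, y)) \<in> ?E\<^sup>*" by (meson converse_rtrancl_into_rtrancl r_into_rtrancl)
      then show ?thesis using * by simp
    next
      fix x y assume *: "u = Inr x" "v = Inl y"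
      have "(place 0 1 u, place 0 1 v) \<in> ?E" "(place 2 1 v, place 2 1 u) \<in> ?E"
        "(place 2 3 u, place 2 3 v) \<in> ?E"
        using uv same_blockD(3)[OF a uv] by (simp_all add: edgesI)
      then have "((1, x), (0, y)) \<in> ?E" "((2, y), (1, x)) \<in> ?E" "((3, x), (2, y)) \<in> ?E"
        using * by auto
      then have "((3, x), (0, y)) \<in> ?E\<^sup>*" by (meson converse_rtrancl_into_rtrancl r_into_rtrancl)
      then show ?thesis using * by simp
    qed
  qed
  ultimately have "(u, v) \<in> same_block (part_mult X \<alpha> (part_mult X (part_star \<alpha>) \<alpha>)) \<longleftrightarrow>
      (u, v) \<in> same_block \<alpha>" for u v
    using part_mult_triple_right[OF a part_star_part[OF a] a, of u v] same_blockD(1,2)[OF a, of u v]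
    by (auto simp: edges_star)
  then show "same_block (part_mult X \<alpha> (part_mult X (part_star \<alpha>) \<alpha>)) = same_block \<alpha>"
    by (intro Set.set_eqI, clarify)
qed (intro part_star_part part_mult_part a)+

definition part_one :: "'a set \<Rightarrow> 'a part" where
  "part_one X = (\<lambda>x. {Inl x, Inr x}) ` X"

lemma part_one_part: "partition_on (vertices X) (part_one X)"
  by (rule partition_onI) (auto simp: part_one_def vertices_def disjnt_def)

lemma part_one_star: "part_star (part_one X) = part_one X"
  by (simp add: part_star_def part_one_def image_image insert_commute)

text \<open>The graph folds onto \<open>\<alpha>\<close> by identifying layer 0 with layer 1.\<close>

lemma part_one_mult:
  assumes a: "partition_on (vertices X) \<alpha>"
  shows "part_mult X (part_one X) \<alpha> = \<alpha>"
proof (rule same_block_inject[of "vertices X"])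
  let ?E = "edges 0 1 (part_one X) \<union> edges 1 2 \<alpha>"
  define f :: "nat \<times> 'a \<Rightarrow> 'a + 'a" where "f = (\<lambda>(i, x). if i = 2 then Inr x else Inl x)"
  have one: "(u, v) \<in> same_block (part_one X) \<longleftrightarrow> (\<exists>x\<in>X. {u, v} \<subseteq> {Inl x, Inr x})" for u v
    by (auto simp: same_block_def part_one_def)
  have fold1: "(f p, f q) \<in> same_block \<alpha>" if pq: "(p, q) \<in> edges 0 1 (part_one X)" for p q
  proof -
    obtain u v where uv: "(u, v) \<in> same_block (part_one X)" "p = place 0 1 u" "q = place 0 1 v"
      using pq by (rule edgesE)
    then obtain x where x: "x \<in> X" "u \<in> {Inl x, Inr x}" "v \<in> {Inl x, Inr x}" by (auto simp: one)
    then have "f p = Inl x" "f q = Inl x" using uv by (auto simp: f_def)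
    then show ?thesis using x(1) by (simp add: same_block_refl[OF a])
  qed
  have f: "f (place 1 2 u) = u" "f (place 0 2 u) = u" for u by (cases u; simp add: f_def)+
  have fold2: "(f p, f q) \<in> same_block \<alpha>" if "(p, q) \<in> edges 1 2 \<alpha>" for p q
    using that by (auto elim!: edgesE simp: f simp del: One_nat_def)
  have "(u, v) \<in> same_block \<alpha>"
    if uv: "u \<in> vertices X" "(place 0 2 u, place 0 2 v) \<in> ?E\<^sup>*" for u v
  proof -
    have "(f (place 0 2 u), f (place 0 2 v)) \<in> same_block \<alpha>"
    proof (rule rtrancl_fold[OF a uv(2)])
      show "f (place 0 2 u) \<in> vertices X" using uv(1) by (simp add: f)
      show "(f p, f q) \<in> same_block \<alpha>" if "(p, q) \<in> ?E" for p q
        using that by (rule UnE) (rule fold1 fold2, assumption)+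
    qed
    then show ?thesis by (simp add: f)
  qed
  moreover have "(place 0 2 u, place 0 2 v) \<in> ?E\<^sup>*" if uv: "(u, v) \<in> same_block \<alpha>" for u v
  proof -
    have down: "(place 0 2 w, place 1 2 w) \<in> ?E\<^sup>*" "(place 1 2 w, place 0 2 w) \<in> ?E\<^sup>*"
      if w: "w \<in> vertices X" for w
    proof -
      have "(place 0 1 (Inl x), place 0 1 (Inr x)) \<in> ?E" "(place 0 1 (Inr x), place 0 1 (Inl x)) \<in> ?E"
        if "x \<in> X" for x
        using that by (auto intro!: UnI1 edgesI simp only: one)
      then show "(place 0 2 w, place 1 2 w) \<in> ?E\<^sup>*" "(place 1 2 w, place 0 2 w) \<in> ?E\<^sup>*"
        using w by (cases w; auto)+
    qed
    have "(place 1 2 u, place 1 2 v) \<in> ?E" using uv by (simp add: edgesI)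
    then show ?thesis
      using down(1)[OF same_blockD(1)[OF a uv]] down(2)[OF same_blockD(2)[OF a uv]]
      by (meson rtrancl.rtrancl_into_rtrancl rtrancl_trans)
  qed
  ultimately have "(u, v) \<in> same_block (part_mult X (part_one X) \<alpha>) \<longleftrightarrow> (u, v) \<in> same_block \<alpha>" for u v
    using same_block_mult[OF part_one_part a, of 0 1 2 u v] same_blockD(1,2)[OF a, of u v] by auto
  then show "same_block (part_mult X (part_one X) \<alpha>) = same_block \<alpha>"
    by (intro Set.set_eqI, clarify)
qed (intro part_one_part part_mult_part a)+

lemma part_mult_one:
  assumes a: "partition_on (vertices X) \<alpha>"
  shows "part_mult X \<alpha> (part_one X) = \<alpha>"
proof -
  have "part_star (part_mult X \<alpha> (part_one X)) = part_star \<alpha>"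
    using part_star_mult[OF a part_one_part] part_one_mult[OF part_star_part[OF a]]
    by (simp add: part_one_star)
  then have "part_star (part_star (part_mult X \<alpha> (part_one X))) = part_star (part_star \<alpha>)"
    by (rule arg_cong)
  then show ?thesis by simp
qed

section \<open>Full-domain partitions\<close>

lemma part_dom_eq: "part_dom \<alpha> = {x. \<exists>y. (Inl x, Inr y) \<in> same_block \<alpha>}"
  by (auto simp: part_dom_def transversal_def same_block_def)

lemma part_codom_eq: "part_codom \<alpha> = {x. \<exists>y. (Inl y, Inr x) \<in> same_block \<alpha>}"
  by (auto simp: part_codom_def transversal_def same_block_def)

lemma full_domain_iff:
  assumes "partition_on (vertices X) \<alpha>"
  shows "part_dom \<alpha> = X \<longleftrightarrow> (\<forall>x\<in>X. \<exists>y. (Inl x, Inr y) \<in> same_block \<alpha>)"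
  using same_blockD(1)[OF assms] by (fastforce simp: part_dom_eq)

lemma part_dom_star:
  assumes "partition_on (vertices X) \<alpha>"
  shows "part_dom (part_star \<alpha>) = part_codom \<alpha>"
  using same_blockD(3)[OF assms] by (auto simp: part_dom_eq part_codom_eq same_block_star)

definition full_domain :: "'a set \<Rightarrow> 'a part set" where
  "full_domain X = {\<alpha>. partition_on (vertices X) \<alpha> \<and> part_dom \<alpha> = X}"

lemma full_domainD:
  assumes "\<alpha> \<in> full_domain X"
  shows "partition_on (vertices X) \<alpha>" "x \<in> X \<Longrightarrow> \<exists>y\<in>X. (Inl x, Inr y) \<in> same_block \<alpha>"
proof -
  show p: "partition_on (vertices X) \<alpha>" using assms by (simp add: full_domain_def)
  have "\<forall>x\<in>X. \<exists>y. (Inl x, Inr y) \<in> same_block \<alpha>"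
    using assms full_domain_iff[OF p] by (simp add: full_domain_def)
  then show "\<exists>y\<in>X. (Inl x, Inr y) \<in> same_block \<alpha>" if "x \<in> X"
  proof -
    obtain y where y: "(Inl x, Inr y) \<in> same_block \<alpha>"
      using \<open>\<forall>x\<in>X. \<exists>y. (Inl x, Inr y) \<in> same_block \<alpha>\<close> \<open>x \<in> X\<close> by blast
    then show ?thesis using same_blockD(2)[OF p y] by auto
  qed
qed

lemma full_domainI:
  assumes "partition_on (vertices X) \<alpha>" "\<And>x. x \<in> X \<Longrightarrow> \<exists>y. (Inl x, Inr y) \<in> same_block \<alpha>"
  shows "\<alpha> \<in> full_domain X"
  using assms full_domain_iff[OF assms(1)] by (simp add: full_domain_def)

lemma full_domain_mult:
  assumes a: "\<alpha> \<in> full_domain X" and b: "\<beta> \<in> full_domain X"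
  shows "part_mult X \<alpha> \<beta> \<in> full_domain X"
proof (rule full_domainI)
  note p = full_domainD(1)[OF a] full_domainD(1)[OF b]
  show "partition_on (vertices X) (part_mult X \<alpha> \<beta>)" by (rule part_mult_part[OF p])
  fix x assume x: "x \<in> X"
  obtain y where y: "y \<in> X" "(Inl x, Inr y) \<in> same_block \<alpha>" using full_domainD(2)[OF a x] by auto
  obtain z where z: "z \<in> X" "(Inl y, Inr z) \<in> same_block \<beta>" using full_domainD(2)[OF b y(1)] by auto
  have "((0, x), (1, y)) \<in> edges 0 1 \<alpha> \<union> edges 1 2 \<beta>" using edgesI[OF y(2), of 0 1] by simp
  moreover have "((1, y), (2, z)) \<in> edges 0 1 \<alpha> \<union> edges 1 2 \<beta>" using edgesI[OF z(2), of 1 2] by simp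
  ultimately have "((0, x), (2, z)) \<in> (edges 0 1 \<alpha> \<union> edges 1 2 \<beta>)\<^sup>*"
    by (meson converse_rtrancl_into_rtrancl r_into_rtrancl)
  then show "\<exists>z. (Inl x, Inr z) \<in> same_block (part_mult X \<alpha> \<beta>)"
    using same_block_mult[OF p, of 0 1 2 "Inl x" "Inr z"] x z(1) by auto
qed

text \<open>A path from the top to the bottom layer has to leave the top layer, and it can do so only within
  a transversal of \<open>\<alpha>\<close>.\<close>

lemma full_domain_left_factor:
  assumes a: "partition_on (vertices X) \<alpha>" and b: "partition_on (vertices X) \<beta>"
    and ab: "part_mult X \<alpha> \<beta> \<in> full_domain X"
  shows "\<alpha> \<in> full_domain X"
proof (rule full_domainI[OF a])
  fix x assume x: "x \<in> X"
  obtain z where "z \<in> X" "(Inl x, Inr z) \<in> same_block (part_mult X \<alpha> \<beta>)"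
    using full_domainD(2)[OF ab x] by auto
  then have path: "((0, x), (2, z)) \<in> (edges 0 1 \<alpha> \<union> edges 1 2 \<beta>)\<^sup>*"
    using same_block_mult[OF a b, of 0 1 2 "Inl x" "Inr z"] by auto
  have "(\<exists>y. (Inl x, Inr y) \<in> same_block \<alpha>) \<or> (\<exists>w. q = (0, w) \<and> (Inl x, Inl w) \<in> same_block \<alpha>)"
    if "((0, x), q) \<in> (edges 0 1 \<alpha> \<union> edges 1 2 \<beta>)\<^sup>*" for q
    using that
  proof induction
    case base
    show ?case using same_block_refl[OF a, of "Inl x"] x by auto
  next
    case (step q q')
    show ?case
    proof (cases "\<exists>y. (Inl x, Inr y) \<in> same_block \<alpha>")
      case False
      then obtain w where w: "q = (0, w)" "(Inl x, Inl w) \<in> same_block \<alpha>" using step.IH by auto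
      have "(q, q') \<notin> edges 1 2 \<beta>"
        using edges_layers(1)[OF b, of q q' 1 2] w(1) by auto
      then have "(q, q') \<in> edges 0 1 \<alpha>" using step.hyps(2) by auto
      then obtain u v where uv: "(u, v) \<in> same_block \<alpha>" "q = place 0 1 u" "q' = place 0 1 v"
        by (rule edgesE)
      have "u = Inl w" using uv(2) w(1) by (cases u) simp_all
      then have "(Inl x, v) \<in> same_block \<alpha>" using same_block_trans[OF a w(2)] uv(1) by simp
      then show ?thesis using uv(3) False by (cases v) auto
    qed blast
  qed
  from this[OF path] show "\<exists>y. (Inl x, Inr y) \<in> same_block \<alpha>" by auto
qed

text \<open>Partitions that join every \<open>x\<close> to \<open>x'\<close> correspond to equivalence relations on \<open>X\<close>.\<close>

definition diagonal :: "'a set \<Rightarrow> 'a part \<Rightarrow> bool" where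
  "diagonal X \<alpha> \<longleftrightarrow> (\<forall>x\<in>X. (Inl x, Inr x) \<in> same_block \<alpha>)"

definition base :: "'a + 'a \<Rightarrow> 'a" where
  "base = case_sum id id"

lemma base_simps [simp]: "base (Inl x) = x" "base (Inr x) = x"
  by (simp_all add: base_def)

lemma diagonal_base:
  assumes p: "partition_on (vertices X) \<alpha>" and d: "diagonal X \<alpha>"
    and u: "u \<in> {Inl x, Inr x}" "v \<in> {Inl y, Inr y}" and x: "x \<in> X" "y \<in> X"
  shows "(u, v) \<in> same_block \<alpha> \<longleftrightarrow> (Inl x, Inl y) \<in> same_block \<alpha>"
proof -
  have *: "(Inl z, w) \<in> same_block \<alpha>" if "z \<in> X" "w \<in> {Inl z, Inr z}" for z w
    using that d same_block_refl[OF p, of "Inl z"] by (auto simp: diagonal_def)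
  show ?thesis
    using *[OF x(1) u(1)] *[OF x(2) u(2)]
    by (meson same_block_trans[OF p] same_blockD(3)[OF p])
qed

lemma diagonal_baseI:
  assumes p: "partition_on (vertices X) \<alpha>" and d: "diagonal X \<alpha>" and uv: "(u, v) \<in> same_block \<alpha>"
  shows "(Inl (base u), Inl (base v)) \<in> same_block \<alpha>" "(Inr (base u), Inr (base v)) \<in> same_block \<alpha>"
proof -
  have X: "base u \<in> X" "base v \<in> X" using same_blockD(1,2)[OF p uv] by (auto simp: vertices_def)
  have m: "u \<in> {Inl (base u), Inr (base u)}" "v \<in> {Inl (base v), Inr (base v)}"
    by (cases u; simp) (cases v; simp)
  show l: "(Inl (base u), Inl (base v)) \<in> same_block \<alpha>" using diagonal_base[OF p d m X] uv by simp
  show "(Inr (base u), Inr (base v)) \<in> same_block \<alpha>"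
    using diagonal_base[OF p d _ _ X, of "Inr (base u)" "Inr (base v)"] l by simp
qed

lemma diagonal_inject:
  assumes a: "partition_on (vertices X) \<alpha>" "diagonal X \<alpha>" and b: "partition_on (vertices X) \<beta>" "diagonal X \<beta>"
    and eq: "\<And>x y. (Inl x, Inl y) \<in> same_block \<alpha> \<longleftrightarrow> (Inl x, Inl y) \<in> same_block \<beta>"
  shows "\<alpha> = \<beta>"
proof (rule same_block_inject[OF a(1) b(1)])
  have "(u, v) \<in> same_block \<beta>"
    if ab: "(u, v) \<in> same_block \<alpha>" and a: "partition_on (vertices X) \<alpha>" "diagonal X \<alpha>" and b: "partition_on (vertices X) \<beta>" "diagonal X \<beta>"
    and eq: "\<And>x y. (Inl x, Inl y) \<in> same_block \<alpha> \<longleftrightarrow> (Inl x, Inl y) \<in> same_block \<beta>"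
    for u v \<alpha> \<beta>
  proof -
    have X: "base u \<in> X" "base v \<in> X" using same_blockD(1,2)[OF a(1) ab] by (auto simp: vertices_def)
    have m: "u \<in> {Inl (base u), Inr (base u)}" "v \<in> {Inl (base v), Inr (base v)}"
      by (cases u; simp) (cases v; simp)
    show ?thesis using diagonal_base[OF b m X] diagonal_baseI(1)[OF a ab] eq by simp
  qed
  from this[OF _ a b eq] this[OF _ b a eq[symmetric]]
  show "same_block \<alpha> = same_block \<beta>" by auto
qed

lemma diagonal_mult_star:
  assumes a: "\<alpha> \<in> full_domain X"
  shows "diagonal X (part_mult X \<alpha> (part_star \<alpha>))"
  unfolding diagonal_def
proof
  fix x assume x: "x \<in> X"
  note p = full_domainD(1)[OF a]
  obtain y where y: "(Inl x, Inr y) \<in> same_block \<alpha>" using full_domainD(2)[OF a x] by auto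
  let ?E = "edges 0 1 \<alpha> \<union> edges 2 1 \<alpha>"
  have "((0, x), (1, y)) \<in> ?E" using edgesI[OF y, of 0 1] by simp
  moreover have "((1, y), (2, x)) \<in> ?E" using edgesI[OF same_blockD(3)[OF p y], of 2 1] by simp
  ultimately have "((0, x), (2, x)) \<in> ?E\<^sup>*" by (meson converse_rtrancl_into_rtrancl r_into_rtrancl)
  then show "(Inl x, Inr x) \<in> same_block (part_mult X \<alpha> (part_star \<alpha>))"
    using same_block_mult[OF p part_star_part[OF p], of 0 1 2 "Inl x" "Inr x"] x by (simp add: edges_star)
qed

text \<open>The graph of \<open>\<alpha> \<alpha>\<^sup>\<star>\<close> folds onto \<open>\<alpha>\<close> along its mirror symmetry.\<close>

lemma upper_mult_star:
  assumes p: "partition_on (vertices X) \<alpha>"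
  shows "(Inl x, Inl y) \<in> same_block (part_mult X \<alpha> (part_star \<alpha>)) \<longleftrightarrow> (Inl x, Inl y) \<in> same_block \<alpha>"
proof -
  let ?E = "edges 0 1 \<alpha> \<union> edges 2 1 \<alpha>"
  define f :: "nat \<times> 'a \<Rightarrow> 'a + 'a" where "f = (\<lambda>(i, x). if even i then Inl x else Inr x)"
  have f: "f (place i j u) = u" if "even i" "odd j" for i j u
    using that by (cases u) (simp_all add: f_def)
  have fold: "(f p, f q) \<in> same_block \<alpha>" if "(p, q) \<in> ?E" for p q
    using that by (auto elim!: edgesE simp: f)
  have "(Inl x, Inl y) \<in> same_block \<alpha>" if "x \<in> X" "((0, x), (0, y)) \<in> ?E\<^sup>*"
    using rtrancl_fold[OF p that(2), of f] that(1) fold by (simp add: f_def)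
  moreover have "((0, x), (0, y)) \<in> ?E\<^sup>*" if "(Inl x, Inl y) \<in> same_block \<alpha>"
    using edgesI[OF that, of 0 1] by auto
  ultimately show ?thesis
    using same_block_mult[OF p part_star_part[OF p], of 0 1 2 "Inl x" "Inl y"] same_blockD(1,2)[OF p, of "Inl x" "Inl y"]
    by (auto simp: edges_star)
qed

text \<open>Two partitions joining each \<open>x\<close> to \<open>x'\<close> commute: their product is the join of two equivalence
  relations, and its graph can be redrawn within the middle layer.\<close>

lemma diagonal_commute:
  assumes a: "partition_on (vertices X) \<alpha>" "diagonal X \<alpha>" and b: "partition_on (vertices X) \<beta>" "diagonal X \<beta>"
  shows "part_mult X \<alpha> \<beta> = part_mult X \<beta> \<alpha>"
proof -
  have sub: "same_block (part_mult X \<alpha> \<beta>) \<subseteq> same_block (part_mult X \<beta> \<alpha>)"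
    if a: "partition_on (vertices X) \<alpha>" "diagonal X \<alpha>" and b: "partition_on (vertices X) \<beta>" "diagonal X \<beta>"
    for \<alpha> \<beta>
  proof (rule subrelI)
    fix u v assume uv: "(u, v) \<in> same_block (part_mult X \<alpha> \<beta>)"
    let ?E = "edges 0 1 \<beta> \<union> edges 1 2 \<alpha>"
    define f :: "nat \<times> 'a \<Rightarrow> nat \<times> 'a" where "f = (\<lambda>p. (1, snd p))"
    have f: "f (place i j w) = (1, base w)" for i j w by (cases w) (simp_all add: f_def)
    have V: "u \<in> vertices X" "v \<in> vertices X"
      and path: "(place 0 2 u, place 0 2 v) \<in> (edges 0 1 \<alpha> \<union> edges 1 2 \<beta>)\<^sup>*"
      using uv same_block_mult[OF a(1) b(1), of 0 1 2 u v] by auto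
    have step: "(f p, f q) \<in> ?E\<^sup>*" if pq: "(p, q) \<in> edges 0 1 \<alpha> \<union> edges 1 2 \<beta>" for p q
      using pq
    proof
      assume "(p, q) \<in> edges 0 1 \<alpha>"
      then obtain w z where "(w, z) \<in> same_block \<alpha>" "p = place 0 1 w" "q = place 0 1 z" by (rule edgesE)
      then show ?thesis using edgesI[OF diagonal_baseI(1)[OF a], of w z 1 2] by (simp add: f r_into_rtrancl)
    next
      assume "(p, q) \<in> edges 1 2 \<beta>"
      then obtain w z where "(w, z) \<in> same_block \<beta>" "p = place 1 2 w" "q = place 1 2 z" by (rule edgesE)
      then show ?thesis using edgesI[OF diagonal_baseI(2)[OF b], of w z 0 1] by (simp add: f r_into_rtrancl)
    qed
    have mid: "((1, base u), (1, base v)) \<in> ?E\<^sup>*"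
      using rtrancl_hom[OF path, of f, OF step] by (simp only: f)
    have vert: "(place 0 2 w, (1, base w)) \<in> ?E \<and> ((1, base w), place 0 2 w) \<in> ?E" if w: "w \<in> vertices X" for w
    proof (cases w)
      case (Inl x)
      then have x: "(Inl x, Inr x) \<in> same_block \<beta>" using w b(2) by (simp add: diagonal_def)
      show ?thesis using Inl edgesI[OF x, of 0 1] edgesI[OF same_blockD(3)[OF b(1) x], of 0 1] by simp
    next
      case (Inr x)
      then have x: "(Inl x, Inr x) \<in> same_block \<alpha>" using w a(2) by (simp add: diagonal_def)
      show ?thesis using Inr edgesI[OF x, of 1 2] edgesI[OF same_blockD(3)[OF a(1) x], of 1 2] by simp
    qed
    have "(place 0 2 u, place 0 2 v) \<in> ?E\<^sup>*"
      using vert[OF V(1)] mid vert[OF V(2)]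
      by (meson converse_rtrancl_into_rtrancl rtrancl.rtrancl_into_rtrancl)
    then show "(u, v) \<in> same_block (part_mult X \<beta> \<alpha>)"
      using same_block_mult[OF b(1) a(1), of 0 1 2 u v] V by simp
  qed
  show ?thesis
    using sub[OF a b] sub[OF b a]
    by (intro same_block_inject[of "vertices X"] part_mult_part a(1) b(1)) auto
qed

lemma partition_monoid_simps [simp]:
  "carrier (partition_monoid X) = {\<alpha>. partition_on (vertices X) \<alpha>}"
  "monoid.mult (partition_monoid X) = part_mult X"
  "one (partition_monoid X) = part_one X"
  by (simp_all add: partition_monoid_def part_one_def)

lemma partition_star_submonoid:
  assumes "finite X"
  shows "star_submonoid (partition_monoid X) part_star (full_domain X)"
proof (rule star_submonoid.intro)
  show "monoid (partition_monoid X)"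
    by (rule monoidI)
      (auto simp: part_mult_part part_one_part part_mult_assoc part_one_mult part_mult_one)
  show "star_submonoid_axioms (partition_monoid X) part_star (full_domain X)"
  proof
    have "finite (vertices X)" using assms by (simp add: vertices_def)
    then show "finite (carrier (partition_monoid X))" by (simp add: finitely_many_partition_on)
    show "\<one>\<^bsub>partition_monoid X\<^esub> \<in> full_domain X"
    proof -
      have "(Inl x, Inr x) \<in> same_block (part_one X)" if "x \<in> X" for x :: 'a
        using that by (auto simp: same_block_def part_one_def)
      then have "part_one X \<in> full_domain X" by (intro full_domainI part_one_part) blast
      then show ?thesis by simp
    qed
    show "x \<otimes>\<^bsub>partition_monoid X\<^esub> part_star x \<otimes>\<^bsub>partition_monoid X\<^esub> (y \<otimes>\<^bsub>partition_monoid X\<^esub> part_star y) =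
        y \<otimes>\<^bsub>partition_monoid X\<^esub> part_star y \<otimes>\<^bsub>partition_monoid X\<^esub> (x \<otimes>\<^bsub>partition_monoid X\<^esub> part_star x)"
      if x: "x \<in> full_domain X" and y: "y \<in> full_domain X" for x y
      using diagonal_commute[OF part_mult_part[OF full_domainD(1)[OF x] part_star_part[OF full_domainD(1)[OF x]]]
          diagonal_mult_star[OF x] part_mult_part[OF full_domainD(1)[OF y] part_star_part[OF full_domainD(1)[OF y]]]
          diagonal_mult_star[OF y]]
      by simp
  next
    fix x y assume "x \<in> carrier (partition_monoid X)" "y \<in> carrier (partition_monoid X)"
      "x \<otimes>\<^bsub>partition_monoid X\<^esub> y \<in> full_domain X"
    then show "x \<in> full_domain X" using full_domain_left_factor[of X x y] by simp
  qed (auto simp: part_star_part part_star_mult part_regular full_domain_mult dest: full_domainD(1))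
qed

section \<open>The maximal subgroups are symmetric groups\<close>

text \<open>When every block meets the layer embedded by \<open>i\<close>, a block can be recovered from its part in that
  layer, which is a class of the equivalence relation induced there. Used for both layers.\<close>

lemma blocks_trace_bij:
  assumes p: "partition_on V h" and K: "K = {(x, y). (i x, i y) \<in> same_block h}"
    and meet: "\<And>B. B \<in> h \<Longrightarrow> \<exists>x. i x \<in> B" and X: "\<And>x. i x \<in> V \<longleftrightarrow> x \<in> X"
  shows "bij_betw (\<lambda>B. i -` B) h (X // K)"
proof -
  have unique: "B = C" if "B \<in> h" "C \<in> h" "u \<in> B" "u \<in> C" for B C u
    using that p by (auto simp: partition_on_def disjoint_def)
  have trace: "i -` B = K `` {x}" if "B \<in> h" "i x \<in> B" for B x
  proof (rule Set.set_eqI)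
    fix y
    have "y \<in> K `` {x} \<longleftrightarrow> (\<exists>C\<in>h. i x \<in> C \<and> i y \<in> C)" by (simp add: K same_block_def)
    also have "\<dots> \<longleftrightarrow> i y \<in> B" using that unique by blast
    finally show "y \<in> i -` B \<longleftrightarrow> y \<in> K `` {x}" by simp
  qed
  show ?thesis
  proof (rule bij_betw_imageI)
    show "inj_on (\<lambda>B. i -` B) h"
    proof (rule inj_onI)
      fix B C assume BC: "B \<in> h" "C \<in> h" "i -` B = i -` C"
      then obtain x where "i x \<in> B" using meet by blast
      then show "B = C" using BC unique by blast
    qed
    show "(\<lambda>B. i -` B) ` h = X // K"
    proof
      show "(\<lambda>B. i -` B) ` h \<subseteq> X // K"
      proof (rule image_subsetI)
        fix B assume B: "B \<in> h"
        then obtain x where x: "i x \<in> B" using meet by blast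
        then have "x \<in> X" using B p X by (auto simp: partition_on_def)
        then show "i -` B \<in> X // K" unfolding trace[OF B x] by (rule quotientI)
      qed
      show "X // K \<subseteq> (\<lambda>B. i -` B) ` h"
      proof
        fix A assume "A \<in> X // K"
        then obtain x where x: "x \<in> X" "A = K `` {x}" by (rule quotientE)
        then obtain B where "B \<in> h" "i x \<in> B" using p X[of x] by (auto simp: partition_on_def)
        then show "A \<in> (\<lambda>B. i -` B) ` h" using trace x(2) by blast
      qed
    qed
  qed
qed

text \<open>These are the bijections from \<open>X / K\<close> to itself, seen as partitions: the maximal subgroup of
  \<open>\<J>\<^sub>X\<close> at the projection given by the equivalence relation \<open>K\<close>.\<close>

definition block_bijections :: "'a set \<Rightarrow> 'a rel \<Rightarrow> 'a part set" where
  "block_bijections X K = {h. partition_on (vertices X) h \<and> part_dom h = X \<and> part_codom h = X \<and>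
     {(x, y). (Inl x, Inl y) \<in> same_block h} = K \<and> {(x, y). (Inr x, Inr y) \<in> same_block h} = K}"

lemma block_bijections_permutations:
  assumes K: "equiv X K"
  shows "bij_betw (\<lambda>\<pi>. (\<lambda>A. A <+> \<pi> A) ` (X // K)) {\<pi>. \<pi> permutes X // K} (block_bijections X K)"
    (is "bij_betw ?F ?P ?L")
proof (rule bij_betw_imageI)
  let ?Q = "X // K"
  have ne: "A \<noteq> {}" if "A \<in> ?Q" for A using K that by (rule in_quotient_imp_non_empty)
  have disj: "A = B" if "A \<in> ?Q" "B \<in> ?Q" "x \<in> A" "x \<in> B" for A B x
    using quotient_disj[OF K that(1,2)] that(3,4) by auto
  have cover: "\<exists>A\<in>?Q. x \<in> A" if "x \<in> X" for x using Union_quotient[OF K] that by auto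
  have sub: "A \<subseteq> X" if "A \<in> ?Q" for A using K that by (rule in_quotient_imp_subset)
  have inQ: "(\<exists>A\<in>?Q. x \<in> A \<and> y \<in> A) \<longleftrightarrow> (x, y) \<in> K" for x y
  proof -
    have "(x, y) \<in> same_block (X // K) \<longleftrightarrow> (x, y) \<in> K" by (simp only: same_block_quotient[OF K])
    then show ?thesis by (simp only: same_block_def mem_Collect_eq case_prod_conv)
  qed
  show "inj_on ?F ?P"
  proof (rule inj_onI)
    fix \<pi> \<sigma> assume perm: "\<pi> \<in> ?P" "\<sigma> \<in> ?P" and eq: "?F \<pi> = ?F \<sigma>"
    show "\<pi> = \<sigma>"
    proof
      fix A
      show "\<pi> A = \<sigma> A"
      proof (cases "A \<in> ?Q")
        case True
        then have "A <+> \<pi> A \<in> ?F \<sigma>" using eq by blast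
        then obtain B where "A <+> \<pi> A = B <+> \<sigma> B" by auto
        then have "Inl -` (A <+> \<pi> A) = Inl -` (B <+> \<sigma> B)" "Inr -` (A <+> \<pi> A) = Inr -` (B <+> \<sigma> B)"
          by simp_all
        then have "A = B" "\<pi> A = \<sigma> B" by (auto simp: Plus_def)
        then show ?thesis by simp
      next
        case False
        then show ?thesis using perm permutes_not_in[of \<pi> ?Q A] permutes_not_in[of \<sigma> ?Q A] by simp
      qed
    qed
  qed
  show "?F ` ?P = ?L"
  proof
    show "?F ` ?P \<subseteq> ?L"
    proof (rule image_subsetI)
      fix \<pi> assume "\<pi> \<in> ?P"
      then have perm: "\<pi> permutes ?Q" by simp
      have piQ: "\<pi> A \<in> ?Q" if "A \<in> ?Q" for A using permutes_in_image[OF perm] that by simp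
      have onto: "\<exists>A\<in>?Q. B = \<pi> A" if "B \<in> ?Q" for B using permutes_image[OF perm] that by blast
      have inj: "A = B" if "\<pi> A = \<pi> B" for A B using permutes_inj[OF perm] that by (rule injD)
      have part: "partition_on (vertices X) (?F \<pi>)"
      proof (rule partition_onI)
        show "\<Union> (?F \<pi>) = vertices X"
        proof (rule Set.set_eqI)
          fix u
          show "u \<in> \<Union> (?F \<pi>) \<longleftrightarrow> u \<in> vertices X"
          proof (cases u)
            case (Inl x)
            then show ?thesis using cover[of x] sub by auto
          next
            case (Inr x)
            have "(\<exists>A\<in>?Q. x \<in> \<pi> A) \<longleftrightarrow> x \<in> X"
            proof
              assume "x \<in> X"
              then obtain B where "B \<in> ?Q" "x \<in> B" using cover by blast
              then show "\<exists>A\<in>?Q. x \<in> \<pi> A" using onto by blast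
            next
              assume "\<exists>A\<in>?Q. x \<in> \<pi> A"
              then show "x \<in> X" using sub piQ by blast
            qed
            then show ?thesis using Inr by auto
          qed
        qed
        show "disjnt C D" if CD: "C \<in> ?F \<pi>" "D \<in> ?F \<pi>" "C \<noteq> D" for C D
        proof -
          obtain A B where AB: "A \<in> ?Q" "B \<in> ?Q" "C = A <+> \<pi> A" "D = B <+> \<pi> B" using CD by auto
          then have "A \<noteq> B" "\<pi> A \<noteq> \<pi> B" using CD(3) inj by auto
          then have "A \<inter> B = {}" "\<pi> A \<inter> \<pi> B = {}"
            using quotient_disj[OF K AB(1,2)] quotient_disj[OF K piQ[OF AB(1)] piQ[OF AB(2)]] by auto
          then show ?thesis unfolding AB(3,4) disjnt_def by auto
        qed
        show "{} \<notin> ?F \<pi>" using ne by (auto simp: Plus_eq_empty_conv)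
      qed
      have ll: "(Inl x, Inl y) \<in> same_block (?F \<pi>) \<longleftrightarrow> (x, y) \<in> K" for x y
        unfolding inQ[symmetric] by (auto simp: same_block_def)
      have lr: "(Inl x, Inr y) \<in> same_block (?F \<pi>) \<longleftrightarrow> (\<exists>A\<in>?Q. x \<in> A \<and> y \<in> \<pi> A)" for x y
        by (auto simp: same_block_def)
      have rr: "(Inr x, Inr y) \<in> same_block (?F \<pi>) \<longleftrightarrow> (x, y) \<in> K" for x y
      proof -
        have "(Inr x, Inr y) \<in> same_block (?F \<pi>) \<longleftrightarrow> (\<exists>A\<in>?Q. x \<in> \<pi> A \<and> y \<in> \<pi> A)"
          by (auto simp: same_block_def)
        also have "\<dots> \<longleftrightarrow> (\<exists>B\<in>?Q. x \<in> B \<and> y \<in> B)" using onto piQ by metis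
        finally show ?thesis by (simp only: inQ)
      qed
      have "part_dom (?F \<pi>) = X"
      proof
        show "part_dom (?F \<pi>) \<subseteq> X" using sub by (auto simp: part_dom_eq lr)
        show "X \<subseteq> part_dom (?F \<pi>)"
        proof
          fix x assume "x \<in> X"
          then obtain A where A: "A \<in> ?Q" "x \<in> A" using cover by blast
          moreover obtain y where "y \<in> \<pi> A" using ne[OF piQ[OF A(1)]] by blast
          ultimately show "x \<in> part_dom (?F \<pi>)" by (auto simp: part_dom_eq lr)
        qed
      qed
      moreover have "part_codom (?F \<pi>) = X"
      proof
        show "part_codom (?F \<pi>) \<subseteq> X" using sub piQ by (fastforce simp: part_codom_eq lr)
        show "X \<subseteq> part_codom (?F \<pi>)"
        proof
          fix y assume "y \<in> X"
          then obtain B where B: "B \<in> ?Q" "y \<in> B" using cover by blast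
          then obtain A where A: "A \<in> ?Q" "B = \<pi> A" using onto by blast
          moreover obtain x where "x \<in> A" using ne[OF A(1)] by blast
          ultimately show "y \<in> part_codom (?F \<pi>)" using B(2) by (auto simp: part_codom_eq lr)
        qed
      qed
      ultimately show "?F \<pi> \<in> ?L" using part by (simp add: block_bijections_def ll rr)
    qed
    show "?L \<subseteq> ?F ` ?P"
    proof
      fix h assume "h \<in> ?L"
      then have h: "partition_on (vertices X) h" "part_dom h = X" "part_codom h = X"
        and Kl: "K = {(x, y). (Inl x, Inl y) \<in> same_block h}"
        and Kr: "K = {(x, y). (Inr x, Inr y) \<in> same_block h}"
        by (auto simp: block_bijections_def)
      have uniq: "B = C" if "B \<in> h" "C \<in> h" "u \<in> B" "u \<in> C" for B C u
        using that h(1) by (auto simp: partition_on_def disjoint_def)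
      have trans: "transversal B" if B: "B \<in> h" for B
      proof -
        have "B \<noteq> {}" using B partition_onD3[OF h(1)] by blast
        then obtain u where "u \<in> B" by blast
        then have u: "u \<in> B" "u \<in> vertices X" using B partition_onD1[OF h(1)] by blast+
        show ?thesis
        proof (cases u)
          case (Inl x)
          then have "x \<in> part_dom h" using u h(2) by simp
          then obtain C where "C \<in> h" "transversal C" "Inl x \<in> C" by (auto simp: part_dom_def)
          then show ?thesis using uniq[OF B] u(1) Inl by blast
        next
          case (Inr x)
          then have "x \<in> part_codom h" using u h(3) by simp
          then obtain C where "C \<in> h" "transversal C" "Inr x \<in> C" by (auto simp: part_codom_def)
          then show ?thesis using uniq[OF B] u(1) Inr by blast
        qed
      qed
      let ?l = "\<lambda>B :: ('a + 'a) set. Inl -` B" and ?r = "\<lambda>B :: ('a + 'a) set. Inr -` B"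
      have l: "bij_betw ?l h ?Q"
        by (rule blocks_trace_bij[OF h(1) Kl]) (use trans in \<open>auto simp: transversal_def\<close>)
      have r: "bij_betw ?r h ?Q"
        by (rule blocks_trace_bij[OF h(1) Kr]) (use trans in \<open>auto simp: transversal_def\<close>)
      define \<pi> where "\<pi> = (\<lambda>A. if A \<in> ?Q then ?r (inv_into h ?l A) else A)"
      have "bij_betw (?r \<circ> inv_into h ?l) ?Q ?Q"
        by (rule bij_betw_trans[OF bij_betw_inv_into[OF l] r])
      then have "bij_betw \<pi> ?Q ?Q"
        by (rule bij_betw_cong[THEN iffD1, rotated]) (simp add: \<pi>_def)
      then have perm: "\<pi> permutes ?Q" by (rule bij_imp_permutes) (simp add: \<pi>_def)
      have "?l B <+> \<pi> (?l B) = B" if B: "B \<in> h" for B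
      proof -
        have "?l B \<in> ?Q" using l B by (rule bij_betwE[THEN bspec])
        moreover have "inv_into h ?l (?l B) = B" by (rule bij_betw_inv_into_left[OF l B])
        ultimately have "\<pi> (?l B) = ?r B" by (simp add: \<pi>_def)
        moreover have "u \<in> ?l B <+> ?r B \<longleftrightarrow> u \<in> B" for u by (cases u) auto
        ultimately show ?thesis by (intro Set.set_eqI) simp
      qed
      then have "(\<lambda>B. ?l B <+> \<pi> (?l B)) ` h = h" by simp
      then have "(\<lambda>A. A <+> \<pi> A) ` (?l ` h) = h" by (simp only: image_image)
      then have "?F \<pi> = h" by (simp only: bij_betw_imp_surj_on[OF l])
      then show "h \<in> ?F ` ?P" using perm by blast
    qed
  qed
qed

lemma card_block_bijections:
  assumes "equiv X K" "finite X"
  shows "card (block_bijections X K) = fact (card (X // K))"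
proof -
  have "finite (X // K)" using assms(2) by (simp add: quotient_def)
  then have "card {\<pi>. \<pi> permutes X // K} = fact (card (X // K))" by (rule card_permutations[OF refl])
  then show ?thesis using bij_betw_same_card[OF block_bijections_permutations[OF assms(1)]] by simp
qed

lemma of_nat_fact_nonzero:
  assumes "CHAR('k::field) = 0 \<or> CHAR('k) > n"
  shows "of_nat (fact n) \<noteq> (0 :: 'k)"
  using assms
proof (induction n)
  case (Suc n)
  have "\<not> CHAR('k) dvd Suc n" using Suc.prems by (auto dest: dvd_imp_le)
  then have "of_nat (Suc n) \<noteq> (0 :: 'k)" by (simp only: of_nat_eq_0_iff_char_dvd not_False_eq_True)
  moreover have "of_nat (fact n) \<noteq> (0 :: 'k)" using Suc by auto
  ultimately show ?case by (simp only: fact_Suc of_nat_mult of_nat_id mult_eq_0_iff) simp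
qed simp

text \<open>The hypothesis on the characteristic makes the order \<open>|X / K|!\<close> of each maximal subgroup of
  \<open>\<J>\<^sub>X\<close> invertible.\<close>

theorem mainTheorem6:
  fixes X :: "'a set"
  assumes "finite X"
    and "CHAR('k::field) = 0 \<or> CHAR('k) > card X"
  shows
    "quotient_algebra (semigroup_algebra (full_domain_monoid X) :: ('k, 'a part \<Rightarrow> 'k) module)
         (jacobson_radical (semigroup_algebra (full_domain_monoid X)))
       \<simeq>\<^sub>a\<^sub>l\<^sub>g (semigroup_algebra (dual_symmetric_inverse_monoid X) :: ('k, 'a part \<Rightarrow> 'k) module)"
proof -
  interpret star_submonoid "partition_monoid X" part_star "full_domain X"
    by (rule partition_star_submonoid[OF assms(1)])
  have J: "J = {\<alpha>. partition_on (vertices X) \<alpha> \<and> part_dom \<alpha> = X \<and> part_codom \<alpha> = X}"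
    (is "_ = ?J")
  proof (rule Set.set_eqI)
    fix \<alpha>
    show "\<alpha> \<in> J \<longleftrightarrow> \<alpha> \<in> ?J"
    proof (cases "partition_on (vertices X) \<alpha>")
      case True
      then show ?thesis
        unfolding J_def by (simp add: full_domain_def part_star_part[OF True] part_dom_star[OF True])
    next
      case False
      then show ?thesis unfolding J_def by (simp add: full_domain_def)
    qed
  qed
  have S_monoid: "full_domain_monoid X = (partition_monoid X)\<lparr>carrier := full_domain X\<rparr>"
    by (simp add: full_domain_monoid_def full_domain_def)
  have J_monoid: "dual_symmetric_inverse_monoid X = (partition_monoid X)\<lparr>carrier := J\<rparr>"
    by (simp add: dual_symmetric_inverse_monoid_def J)
  have "of_nat (card (loops (part_mult X (part_star b) b))) \<noteq> (0 :: 'k)" if b: "b \<in> J" for b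
  proof -
    let ?e = "part_mult X (part_star b) b"
    define K where "K = {(x, y). (Inl x, Inl y) \<in> same_block ?e}"
    have bS: "part_star b \<in> full_domain X" by (rule J_S[OF J_star[OF b]])
    then have bp: "partition_on (vertices X) (part_star b)" by (rule full_domainD)
    then have ep: "partition_on (vertices X) ?e" using part_mult_part[OF bp part_star_part[OF bp]] by simp
    have ed: "diagonal X ?e" using diagonal_mult_star[OF bS] by simp
    have "equiv X K"
    proof (rule equivI)
      show "K \<subseteq> X \<times> X" using same_blockD(1,2)[OF ep] unfolding K_def by fastforce
      show "refl_on X K"
        using same_block_refl[OF ep] by (intro refl_onI) (simp_all add: K_def)
      show "sym K" using same_blockD(3)[OF ep] by (intro symI) (simp add: K_def)
      show "trans K" unfolding trans_def K_def using same_block_trans[OF ep] by blast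
    qed
    \<comment> \<open>A projection with full domain is determined by its equivalence relation on the upper vertices.\<close>
    have proj: "part_mult X h (part_star h) = ?e \<longleftrightarrow> {(x, y). (Inl x, Inl y) \<in> same_block h} = K"
      if h: "h \<in> full_domain X" for h
    proof
      note hp = full_domainD(1)[OF h]
      show "{(x, y). (Inl x, Inl y) \<in> same_block h} = K" if "part_mult X h (part_star h) = ?e"
        using upper_mult_star[OF hp] by (simp add: K_def that[symmetric])
      assume eq: "{(x, y). (Inl x, Inl y) \<in> same_block h} = K"
      show "part_mult X h (part_star h) = ?e"
      proof (rule diagonal_inject[OF part_mult_part[OF hp part_star_part[OF hp]] diagonal_mult_star[OF h] ep ed])
        show "(Inl x, Inl y) \<in> same_block (part_mult X h (part_star h)) \<longleftrightarrow> (Inl x, Inl y) \<in> same_block ?e" for x y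
          using eq unfolding upper_mult_star[OF hp] K_def by blast
      qed
    qed
    have "loops ?e = block_bijections X K"
    proof (rule Set.set_eqI)
      fix h
      show "h \<in> loops ?e \<longleftrightarrow> h \<in> block_bijections X K"
      proof (cases "h \<in> J")
        case True
        have "h \<in> full_domain X" "part_star h \<in> full_domain X"
          by (rule J_S[OF True], rule J_S[OF J_star[OF True]])
        then show ?thesis
          using True proj[of h] proj[of "part_star h"]
          by (simp add: loops_def block_bijections_def J same_block_star)
      next
        case False
        then show ?thesis by (auto simp: loops_def block_bijections_def J)
      qed
    qed
    then have "card (loops ?e) = fact (card (X // K))"
      using card_block_bijections[OF \<open>equiv X K\<close> assms(1)] by simp
    moreover have "card (X // K) \<le> card X"
      using card_image_le[OF assms(1), of "\<lambda>x. K `` {x}"] by (simp add: quotient_def UNION_singleton_eq_range)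
    then have "of_nat (fact (card (X // K))) \<noteq> (0 :: 'k)"
      using assms(2) by (intro of_nat_fact_nonzero) auto
    ultimately show ?thesis by simp
  qed
  then show ?thesis
    unfolding S_monoid J_monoid by (intro semisimple_quotient_iso) simp
qed

end
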